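(* For any integer $m\in\mathbb{Z}^+$, any polynomial expected running time two-way probabilistic finite automaton (2PFA) recognizing the language $C(m)=\{w\mid w\in\Sigma^m\}$ with error probability $\varepsilon<\frac{1}{2}$ has at least $\sqrt[3]{(\log m)/b}$ states, where $b$ is a constant.
   Context: $\Sigma$ is any finite alphabet, and $C(m)$ is the language of all words over $\Sigma$ of length $m$. A 2PFA is a two-way finite automaton (input placed between a left and a right end-marker, head moves in $\{-1,0,1\}$) with finitely many states, among them accepting and rejecting halting states, in which the next state and head movement are chosen according to a probability distribution determined by the current state and the scanned symbol. $\Pr[\mathcal{A}\text{ accepts }w]$ and $\Pr[\mathcal{A}\text{ rejects }w]$ are the probabilities that $\mathcal{A}$ on input $w$ halts in an accepting, respectively rejecting, state. For $0<\varepsilon<\frac12$, $\mathcal{A}$ recognizes $L\subset\Sigma^*$ with error probability $\varepsilon$ if $\Pr[\mathcal{A}\text{ accepts }w]\ge 1-\varepsilon$ for all $w\in L$ and $\Pr[\mathcal{A}\text{ rejects }w]\ge 1-\varepsilon$ for all $w\in\Sigma^*$ with $w\notin L$. Polynomial expected running time means that the expected number of steps until halting is bounded by a polynomial in the length of the input. *)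

theory Defs
  imports "HOL-Probability.Probability" "HOL-Computational_Algebra.Polynomial"
begin

datatype 'a tape_symbol = Left_End | Letter 'a | Right_End

record ('q, 'a) tpfa =
  states :: "'q set"
  delta :: "'q \<Rightarrow> 'a tape_symbol \<Rightarrow> ('q \<times> int) pmf"
  start :: "'q"
  accepting :: "'q set"
  rejecting :: "'q set"

definition halting :: "('q, 'a) tpfa \<Rightarrow> 'q set" where
  "halting A = accepting A \<union> rejecting A"

(* The last two conjuncts keep the head between the two end-markers.
   Transitions out of halting states are irrelevant, hence unconstrained. *)
definition is_2pfa :: "'a set \<Rightarrow> ('q, 'a) tpfa \<Rightarrow> bool" where
  "is_2pfa \<Sigma> A \<longleftrightarrow>
     finite (states A) \<and> start A \<in> states A \<and>
     accepting A \<subseteq> states A \<and> rejecting A \<subseteq> states A \<and>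
     accepting A \<inter> rejecting A = {} \<and>
     (\<forall>q \<in> states A - halting A. \<forall>s \<in> {Left_End, Right_End} \<union> Letter ` \<Sigma>.
        \<forall>(q', d) \<in> set_pmf (delta A q s).
          q' \<in> states A \<and> d \<in> {-1, 0, 1} \<and>
          (s = Left_End \<longrightarrow> d \<noteq> -1) \<and> (s = Right_End \<longrightarrow> d \<noteq> 1))"

(* The left end-marker is in cell 0, the input in cells 1, ..., length w,
   and the right end-marker in cell length w + 1; other cells are never visited. *)
definition tape :: "'a list \<Rightarrow> int \<Rightarrow> 'a tape_symbol" where
  "tape w i =
     (if i \<le> 0 then Left_End
      else if i \<le> int (length w) then Letter (w ! nat (i - 1))
      else Right_End)"

definition step :: "('q, 'a) tpfa \<Rightarrow> 'a list \<Rightarrow> 'q \<times> int \<Rightarrow> ('q \<times> int) pmf" where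
  "step A w = (\<lambda>(q, i). map_pmf (\<lambda>(q', d). (q', i + d)) (delta A q (tape w i)))"

(* Distribution of the configuration (state, head position) reached after exactly t steps;
   None means that the computation halted in fewer than t steps. *)
primrec run :: "('q, 'a) tpfa \<Rightarrow> 'a list \<Rightarrow> nat \<Rightarrow> ('q \<times> int) option pmf" where
  "run A w 0 = return_pmf (Some (start A, 0))"
| "run A w (Suc t) = bind_pmf (run A w t) (\<lambda>x. case x of
      None \<Rightarrow> return_pmf None
    | Some c \<Rightarrow> if fst c \<in> halting A then return_pmf None else map_pmf Some (step A w c))"

definition prob_halts_at :: "('q, 'a) tpfa \<Rightarrow> 'q set \<Rightarrow> 'a list \<Rightarrow> nat \<Rightarrow> ennreal" where
  "prob_halts_at A F w t =
     emeasure (measure_pmf (run A w t)) {Some (q, i) | q i. q \<in> F \<inter> halting A}"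

(* The events of halting after exactly t steps are disjoint for different t. *)
definition prob_accepts :: "('q, 'a) tpfa \<Rightarrow> 'a list \<Rightarrow> ennreal" where
  "prob_accepts A w = (\<Sum>t. prob_halts_at A (accepting A) w t)"

definition prob_rejects :: "('q, 'a) tpfa \<Rightarrow> 'a list \<Rightarrow> ennreal" where
  "prob_rejects A w = (\<Sum>t. prob_halts_at A (rejecting A) w t)"

(* The running time is infinite on non-halting computations, so the second summand is
   infinite if these have positive probability and 0 otherwise. *)
definition expected_steps :: "('q, 'a) tpfa \<Rightarrow> 'a list \<Rightarrow> ennreal" where
  "expected_steps A w =
     (\<Sum>t. of_nat t * prob_halts_at A (halting A) w t) +
     \<infinity> * (1 - (\<Sum>t. prob_halts_at A (halting A) w t))"

definition expected_time_bounded :: "'a set \<Rightarrow> ('q, 'a) tpfa \<Rightarrow> real poly \<Rightarrow> bool" where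
  "expected_time_bounded \<Sigma> A p \<longleftrightarrow>
     (\<forall>w \<in> lists \<Sigma>. expected_steps A w \<le> ennreal (poly p (real (length w))))"

definition recognizes_with_error ::
    "'a set \<Rightarrow> ('q, 'a) tpfa \<Rightarrow> 'a list set \<Rightarrow> real \<Rightarrow> bool" where
  "recognizes_with_error \<Sigma> A L \<epsilon> \<longleftrightarrow>
     (\<forall>w \<in> L. prob_accepts A w \<ge> ennreal (1 - \<epsilon>)) \<and>
     (\<forall>w \<in> lists \<Sigma> - L. prob_rejects A w \<ge> ennreal (1 - \<epsilon>))"

definition C :: "'a set \<Rightarrow> nat \<Rightarrow> 'a list set" where
  "C \<Sigma> m = {w \<in> lists \<Sigma>. length w = m}"

end

theory Submission
  imports Defs
begin

text \<open>Only words over a single letter matter. Cut such a word into a prefix \<open>u\<close> and a suffix \<open>w\<close>. All that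
  the prefix sees of the suffix is the matrix of crossing probabilities, which gives for each state
  entering the suffix the distribution of the state in which the head comes back (or halts). If two
  suffixes \<open>w\<close> and \<open>w'\<close> have crossing matrices that agree up to a factor \<open>exp \<mu>\<close>, apart from entries
  of order \<open>\<theta>\<close>, then the acceptance probabilities of \<open>u w\<close> and \<open>u w'\<close> agree up to a factor
  \<open>exp (4 c \<mu>)\<close>, where \<open>c\<close> is the number of states, and an error of order \<open>c \<theta>\<close> times the expected
  running time: exchanging a single row of the matrix multiplies absorption probabilities by at most the square
  of the factor, and entries of order \<open>\<theta>\<close> are rarely used in polynomial time. Rounding the
  entries logarithmically leaves about \<open>(c log m)\<^bsup>c (c + 1)\<^esup>\<close> classes of matrices, so unless \<open>log m\<close> is
  at most of order \<open>c\<^sup>3\<close>, two suffixes of different lengths at most \<open>m\<close> fall into the same class,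
  and \<open>A\<close> cannot tell a word of length \<open>m\<close> from one of another length.\<close>

section \<open>Least solutions of positive linear equations\<close>

text \<open>Models averaging over one step of a chain that may lose mass: \<open>T F c\<close> is
  the expected value of \<open>F\<close> after a step from \<open>c\<close>. Countable additivity
  lets \<open>T\<close> pass through the series in \<open>star\<close>.\<close>

definition pos_lin :: "(('s \<Rightarrow> ennreal) \<Rightarrow> 's \<Rightarrow> ennreal) \<Rightarrow> bool" where
  "pos_lin T \<longleftrightarrow>
     (\<forall>F G. T (\<lambda>c. F c + G c) = (\<lambda>c. T F c + T G c)) \<and>
     (\<forall>a F. T (\<lambda>c. a * F c) = (\<lambda>c. a * T F c)) \<and>
     (\<forall>F :: nat \<Rightarrow> _. T (\<lambda>c. \<Sum>n. F n c) = (\<lambda>c. \<Sum>n. T (F n) c))"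

text \<open>The Neumann series of \<open>T\<close>: the expected total reward \<open>g\<close>
  collected by a run from \<open>c\<close>, hence an absorption probability when \<open>g\<close>
  marks states in which the run stops.\<close>

definition star :: "(('s \<Rightarrow> ennreal) \<Rightarrow> 's \<Rightarrow> ennreal) \<Rightarrow> ('s \<Rightarrow> ennreal) \<Rightarrow> 's \<Rightarrow> ennreal" where
  "star T g c = (\<Sum>t. (T ^^ t) g c)"

lemma pos_lin_add: "pos_lin T \<Longrightarrow> T (\<lambda>c. F c + G c) = (\<lambda>c. T F c + T G c)"
  by (simp add: pos_lin_def)

lemma pos_lin_cmult: "pos_lin T \<Longrightarrow> T (\<lambda>c. a * F c) = (\<lambda>c. a * T F c)"
  by (simp add: pos_lin_def)

lemma pos_lin_suminf:
  "pos_lin T \<Longrightarrow> T (\<lambda>c. \<Sum>n. F n c) = (\<lambda>c. \<Sum>n. T (F n) c)" for F :: "nat \<Rightarrow> _"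
  by (simp add: pos_lin_def)

lemma pos_lin_zero: "pos_lin T \<Longrightarrow> T (\<lambda>_. 0) = (\<lambda>_. 0)"
  using pos_lin_cmult[of T 0 "\<lambda>_. 0"] by simp

lemma pos_lin_sum:
  assumes "pos_lin T"
  shows "T (\<lambda>c. \<Sum>i\<in>I. F i c) = (\<lambda>c. \<Sum>i\<in>I. T (F i) c)"
proof (cases "finite I")
  case True
  then show ?thesis
    by induction (simp_all add: pos_lin_zero[OF assms] pos_lin_add[OF assms])
qed (simp add: pos_lin_zero[OF assms])

lemma pos_lin_mono:
  assumes "pos_lin T" "\<And>c. F c \<le> G c"
  shows "T F c \<le> T G c"
proof -
  have "G = (\<lambda>c. F c + (G c - F c))"
    using assms(2) by (auto simp: fun_eq_iff ennreal_ineq_diff_add)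
  then have "T G c = T F c + T (\<lambda>c. G c - F c) c"
    using pos_lin_add[OF assms(1)] by metis
  then show ?thesis by simp
qed

lemma pos_lin_restrict:
  assumes "pos_lin T"
  shows "pos_lin (\<lambda>F c. if c \<in> B then T F c else 0)"
  using assms by (auto simp: pos_lin_def fun_eq_iff)

lemma pos_lin_pow: "pos_lin T \<Longrightarrow> pos_lin (T ^^ t)"
  by (induction t) (auto simp: pos_lin_def)

lemma star_unfold:
  assumes "pos_lin T"
  shows "star T g c = g c + T (star T g) c"
proof -
  have "(\<lambda>t. (T ^^ Suc t) g c) sums (\<Sum>t. (T ^^ Suc t) g c)"
    by (simp add: summable_sums)
  then have "(\<lambda>t. (T ^^ t) g c) sums ((\<Sum>t. (T ^^ Suc t) g c) + (T ^^ 0) g c)"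
    by (rule sums_Suc)
  then have "star T g c = (\<Sum>t. T ((T ^^ t) g) c) + g c"
    by (simp add: star_def sums_iff)
  also have "(\<Sum>t. T ((T ^^ t) g) c) = T (star T g) c"
    unfolding star_def[abs_def] using pos_lin_suminf[OF assms, of "\<lambda>t. (T ^^ t) g"] by metis
  finally show ?thesis by (simp add: add.commute)
qed

text \<open>By induction every partial sum of the series stays below \<open>u\<close>, as the next
  one is \<open>g\<close> plus \<open>T\<close> of the present one. Exhibiting such a supersolution
  \<open>u\<close> is the standard way to bound values in what follows.\<close>

lemma star_least:
  assumes T: "pos_lin T" and u: "\<And>c. g c + T u c \<le> u c"
  shows "star T g c \<le> u c"
proof -
  have "(\<Sum>t<n. (T ^^ t) g c) \<le> u c" for n c
  proof (induction n arbitrary: c)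
    case (Suc n)
    have "(\<Sum>t<Suc n. (T ^^ t) g c) = g c + T (\<lambda>c. \<Sum>t<n. (T ^^ t) g c) c"
      unfolding pos_lin_sum[OF T] sum.lessThan_Suc_shift by simp
    also have "\<dots> \<le> g c + T u c"
      by (intro add_left_mono pos_lin_mono[OF T] Suc)
    finally show ?case using u order_trans by blast
  qed simp
  then show ?thesis unfolding star_def by (intro suminf_le_const) auto
qed

lemma star_add:
  assumes "pos_lin T"
  shows "star T (\<lambda>c. g c + h c) c = star T g c + star T h c"
  using pos_lin_add[OF pos_lin_pow[OF assms]] by (simp add: star_def suminf_add)

lemma star_cmult:
  assumes "pos_lin T"
  shows "star T (\<lambda>c. a * g c) c = a * star T g c"
  using pos_lin_cmult[OF pos_lin_pow[OF assms]] by (simp add: star_def)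

lemma star_sum:
  assumes "pos_lin T"
  shows "star T (\<lambda>c. \<Sum>i\<in>I. a i * g i c) c = (\<Sum>i\<in>I. a i * star T (g i) c)"
proof (cases "finite I")
  case True
  then show ?thesis
  proof induction
    case empty
    show ?case using star_cmult[OF assms, of 0 "\<lambda>_. 0"] by simp
  qed (simp add: star_add[OF assms] star_cmult[OF assms])
next
  case False
  then show ?thesis using star_cmult[OF assms, of 0 "\<lambda>_. 0"] by simp
qed

lemma star_mono:
  assumes T: "pos_lin T" and "\<And>c. g c \<le> h c"
  shows "star T g c \<le> star T h c"
  using assms(2) star_unfold[OF T, of h]
  by (intro star_least[OF T]) (metis add_right_mono)

text \<open>The strong Markov property at the first visit to \<open>k\<close>.\<close>

lemma star_first_visit:
  assumes T: "pos_lin T" and gk: "g k = 0"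
  defines "Tk \<equiv> (\<lambda>F c. if c \<in> - {k} then T F c else 0)"
  shows "star T g c = star Tk g c + star T g k * star Tk (indicator {k}) c"
proof -
  let ?V = "star T g"
  have Tk: "pos_lin Tk" unfolding Tk_def by (rule pos_lin_restrict[OF T])
  define u where "u c = star Tk g c + ?V k * star Tk (indicator {k}) c" for c
  have u: "u c = star Tk (\<lambda>c. g c + ?V k * indicator {k} c) c" for c
    by (simp add: u_def star_add[OF Tk] star_cmult[OF Tk])
  \<comment> \<open>The true value satisfies the equation of the chain stopped at \<open>k\<close>
    that pays this value there.\<close>
  have le: "u c \<le> ?V c" for c unfolding u
  proof (rule star_least[OF Tk])
    fix c show "g c + ?V k * indicator {k} c + Tk ?V c \<le> ?V c"
      using gk star_unfold[OF T, of g c] by (cases "c = k") (auto simp: Tk_def)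
  qed
  have unf: "u c = g c + ?V k * indicator {k} c + Tk u c" for c
  proof -
    have "u = star Tk (\<lambda>c. g c + ?V k * indicator {k} c)" using u by (simp add: fun_eq_iff)
    then show ?thesis using star_unfold[OF Tk] by metis
  qed
  \<comment> \<open>Conversely \<open>u\<close> is a supersolution of the unstopped chain; at
    \<open>k\<close> this follows from \<open>le\<close>, since \<open>u k\<close> equals
    \<open>?V k\<close>.\<close>
  have "?V c \<le> u c" for c
  proof (rule star_least[OF T])
    fix c show "g c + T u c \<le> u c"
    proof (cases "c = k")
      case True
      have "g c + T u c \<le> g c + T ?V c"
        by (intro add_left_mono pos_lin_mono[OF T] le)
      also have "\<dots> = ?V c" by (simp add: star_unfold[OF T, symmetric])
      also have "\<dots> = u c" using unf[of k] gk True by (simp add: Tk_def)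
      finally show ?thesis .
    next
      case False
      then show ?thesis using unf[of c] by (simp add: Tk_def)
    qed
  qed
  then show ?thesis using le unfolding u_def by (intro antisym)
qed

text \<open>The value at \<open>k\<close> is a quotient of \<open>N\<close>, the reward collected
  after a step from \<open>k\<close> before any return to \<open>k\<close>, by \<open>D\<close>, the
  chance of no return. The new row has \<open>N' \<le> \<beta> * N\<close> and
  \<open>D \<le> \<beta> * D'\<close>, so the quotient grows by at most
  \<open>\<beta>\<^sup>2\<close>, and other states feel the change only through \<open>k\<close>.
  The slack \<open>\<theta>\<close> of the entries is paid for by the loss
  \<open>z'\<close>.\<close>

lemma star_change_row:
  fixes \<beta> \<theta> :: ennreal and J :: "'s set"
  assumes T: "pos_lin T" "pos_lin T'" and sub: "\<And>c. g c + T (\<lambda>_. 1) c \<le> 1"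
    and same: "\<And>F c. c \<noteq> k \<Longrightarrow> T' F c = T F c"
    and gk: "g k = 0" and beta: "1 \<le> \<beta>"
    and row: "\<And>F. T F k = (\<Sum>j\<in>J. y j * F j)" "\<And>F. T' F k = (\<Sum>j\<in>J. y' j * F j)"
    and tot: "(\<Sum>j\<in>J. y j) + z = 1" "(\<Sum>j\<in>J. y' j) + z' = 1"
    and close: "\<And>j. j \<in> J \<Longrightarrow> y' j \<le> \<beta> * y j" "\<And>j. j \<in> J \<Longrightarrow> y j \<le> \<beta> * y' j + \<theta>"
      "z + of_nat (card J) * \<theta> \<le> \<beta> * z'"
  shows "star T' g c \<le> \<beta>\<^sup>2 * star T g c"
proof -
  define Tk where "Tk \<equiv> (\<lambda>F c. if c \<in> - {k} then T F c else 0)"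
  define r h where "r = star Tk g" and "h = star Tk (indicator {k})"
  let ?V = "star T g"
  have Tk: "pos_lin Tk" unfolding Tk_def by (rule pos_lin_restrict[OF T(1)])
  have V: "?V c = r c + ?V k * h c" for c
    unfolding Tk_def r_def h_def by (rule star_first_visit[of T g k, OF T(1) gk])
  have V1: "?V c \<le> 1" for c using sub by (intro star_least[OF T(1)])
  have h1: "h c \<le> 1" for c unfolding h_def
  proof (rule star_least[OF Tk])
    fix c show "indicator {k} c + Tk (\<lambda>_. 1) c \<le> 1"
      using sub[of c] order_trans[OF add_increasing[of "g c" "T (\<lambda>_. 1) c"] sub[of c]]
      by (auto simp: Tk_def indicator_def)
  qed
  \<comment> \<open>\<open>d j\<close> is the chance of no return to \<open>k\<close> from
    \<open>j\<close>; \<open>D\<close> below also contains the loss \<open>z\<close>, which never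
    returns either.\<close>
  define d where "d j = 1 - h j" for j
  have dh: "d j + h j = 1" for j using h1[of j] by (simp add: d_def diff_add_cancel_ennreal)
  have d1: "d j \<le> 1" for j by (simp add: d_def diff_le_self_ennreal)
  define N N' H H' D D' where "N = (\<Sum>j\<in>J. y j * r j)" and "N' = (\<Sum>j\<in>J. y' j * r j)"
    and "H = (\<Sum>j\<in>J. y j * h j)" and "H' = (\<Sum>j\<in>J. y' j * h j)"
    and "D = (\<Sum>j\<in>J. y j * d j) + z" and "D' = (\<Sum>j\<in>J. y' j * d j) + z'"
  have DH: "D + H = 1" "D' + H' = 1"
  proof -
    have *: "(\<Sum>j\<in>J. x j * d j) + w + (\<Sum>j\<in>J. x j * h j) = (\<Sum>j\<in>J. x j) + w" for x w
    proof -
      have "(\<Sum>j\<in>J. x j * d j) + (\<Sum>j\<in>J. x j * h j) = (\<Sum>j\<in>J. x j * (d j + h j))"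
        by (simp only: sum.distrib distrib_left)
      also have "\<dots> = (\<Sum>j\<in>J. x j)" by (simp only: dh mult_1_right)
      finally show ?thesis by (metis add.commute add.left_commute)
    qed
    show "D + H = 1" "D' + H' = 1" unfolding D_def H_def D'_def H'_def * by (rule tot)+
  qed
  have Vk: "?V k = N + ?V k * H"
  proof -
    have "?V k = (\<Sum>j\<in>J. y j * ?V j)" using star_unfold[OF T(1), of g k] gk row by simp
    also have "\<dots> = (\<Sum>j\<in>J. y j * (r j + ?V k * h j))" by (simp only: V[symmetric])
    also have "\<dots> = (\<Sum>j\<in>J. y j * r j + ?V k * (y j * h j))"
      by (simp only: distrib_left mult.left_commute)
    finally show ?thesis by (simp only: N_def H_def sum.distrib sum_distrib_left)
  qed
  \<comment> \<open>Finiteness permits cancelling \<open>?V k * H\<close> in \<open>ennreal\<close>,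
    which yields \<open>?V k * D = N\<close>, the quotient without division.\<close>
  have "H \<le> D + H" by (rule add_increasing) simp_all
  then have "H \<le> 1" using DH(1) by simp
  then have "?V k * H \<le> 1" using mult_mono[OF V1[of k], of H 1] by simp
  then have fin: "?V k * H \<noteq> \<infinity>" by (auto simp: top_unique)
  have "?V k * H + ?V k * D = ?V k * (D + H)" by (simp only: distrib_left add.commute)
  also have "\<dots> = ?V k * H + N" using Vk by (simp only: DH mult_1_right add.commute)
  finally have VD: "?V k * D = N" using fin by (simp add: ennreal_add_left_cancel)
  have N': "N' \<le> \<beta> * N" unfolding N_def N'_def sum_distrib_left
    by (intro sum_mono) (simp only: mult.assoc[symmetric] mult_right_mono close(1) zero_le)
  have "y j * d j \<le> \<beta> * (y' j * d j) + \<theta>" if "j \<in> J" for j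
  proof -
    have "y j * d j \<le> (\<beta> * y' j + \<theta>) * d j" by (intro mult_right_mono close that) simp
    also have "\<dots> = \<beta> * (y' j * d j) + \<theta> * d j" by (simp only: distrib_right mult.assoc)
    also have "\<dots> \<le> \<beta> * (y' j * d j) + \<theta> * 1" by (intro add_left_mono mult_left_mono d1) simp
    finally show ?thesis by simp
  qed
  then have "(\<Sum>j\<in>J. y j * d j) \<le> (\<Sum>j\<in>J. \<beta> * (y' j * d j) + \<theta>)" by (rule sum_mono)
  then have "(\<Sum>j\<in>J. y j * d j) + z \<le> \<beta> * (\<Sum>j\<in>J. y' j * d j) + of_nat (card J) * \<theta> + z"
    unfolding sum.distrib sum_distrib_left[symmetric] sum_constant by (rule add_right_mono)
  then have "D \<le> \<beta> * (\<Sum>j\<in>J. y' j * d j) + (z + of_nat (card J) * \<theta>)"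
    by (simp only: D_def ac_simps)
  also have "\<dots> \<le> \<beta> * D'" using close(3) by (simp only: D'_def distrib_left add_left_mono)
  finally have D': "D \<le> \<beta> * D'" .
  \<comment> \<open>The candidate supersolution for \<open>T'\<close>: only the weight of visits to
    \<open>k\<close> is raised.\<close>
  define u where "u c = r c + \<beta>\<^sup>2 * ?V k * h c" for c
  have Tu: "T' u c = T' r c + \<beta>\<^sup>2 * ?V k * T' h c" for c
    unfolding u_def[abs_def] pos_lin_add[OF T(2)] pos_lin_cmult[OF T(2)] ..
  have "star T' g c \<le> u c"
  proof (rule star_least[OF T(2)])
    fix c show "g c + T' u c \<le> u c"
    proof (cases "c = k")
      case True
      have rk: "r k = 0" "h k = 1"
        using star_unfold[OF Tk, of g k] star_unfold[OF Tk, of "indicator {k}" k] gk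
        by (simp_all add: r_def h_def Tk_def)
      have "g c + T' u c = N' + \<beta>\<^sup>2 * ?V k * H'"
        using Tu[of c] True gk by (simp add: row N'_def H'_def)
      also have "\<dots> \<le> \<beta> * (?V k * D) + \<beta>\<^sup>2 * ?V k * H'" using N' VD by (simp add: add_right_mono)
      also have "\<dots> \<le> \<beta> * (?V k * (\<beta> * D')) + \<beta>\<^sup>2 * ?V k * H'"
        by (intro add_right_mono mult_left_mono D') auto
      also have "\<dots> = \<beta>\<^sup>2 * ?V k * (D' + H')"
        by (simp only: distrib_left distrib_right power2_eq_square mult_ac)
      also have "\<dots> = u c" using DH True rk by (simp add: u_def)
      finally show ?thesis .
    next
      case False
      then have "r c = g c + T' r c" "h c = T' h c"
        using star_unfold[OF Tk, of g c] star_unfold[OF Tk, of "indicator {k}" c] same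
        by (simp_all add: r_def h_def Tk_def)
      then show ?thesis using Tu[of c] by (simp add: u_def add.assoc)
    qed
  qed
  also have "u c \<le> \<beta>\<^sup>2 * r c + \<beta>\<^sup>2 * ?V k * h c"
    unfolding u_def using mult_right_mono[of 1 "\<beta>\<^sup>2" "r c"] one_le_power[OF beta, of 2]
    by (intro add_right_mono) simp
  also have "\<dots> = \<beta>\<^sup>2 * (r c + ?V k * h c)" by (simp only: distrib_left mult.assoc)
  also have "r c + ?V k * h c = ?V c" by (simp only: V[symmetric])
  finally show ?thesis .
qed

section \<open>Perturbation of jump probabilities\<close>

text \<open>Adds jumps from \<open>K\<close> into \<open>J\<close> with matrix \<open>Y\<close>. In
  a \<open>jump_system\<close> the operator \<open>T\<close> vanishes on \<open>K\<close>, so there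
  \<open>Y\<close> is the whole row. Entries are real because losses are formed by
  subtraction.\<close>

definition jump_op :: "(('s \<Rightarrow> ennreal) \<Rightarrow> 's \<Rightarrow> ennreal) \<Rightarrow> 's set \<Rightarrow> 's set \<Rightarrow> ('s \<Rightarrow> 's \<Rightarrow> real) \<Rightarrow>
    ('s \<Rightarrow> ennreal) \<Rightarrow> 's \<Rightarrow> ennreal" where
  "jump_op T K J Y F c = T F c + (if c \<in> K then \<Sum>j\<in>J. ennreal (Y c j) * F j else 0)"

lemma pos_lin_jump_op:
  assumes T: "pos_lin T"
  shows "pos_lin (jump_op T K J Y)"
  unfolding pos_lin_def
proof (intro conjI allI ext)
  fix F G :: "'a \<Rightarrow> ennreal" and c
  show "jump_op T K J Y (\<lambda>c. F c + G c) c = jump_op T K J Y F c + jump_op T K J Y G c"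
    by (simp add: jump_op_def pos_lin_add[OF T] distrib_left sum.distrib ac_simps)
next
  fix a and F :: "'a \<Rightarrow> ennreal" and c
  show "jump_op T K J Y (\<lambda>c. a * F c) c = a * jump_op T K J Y F c"
    by (simp add: jump_op_def pos_lin_cmult[OF T] distrib_left sum_distrib_left mult.left_commute)
next
  fix F :: "nat \<Rightarrow> 'a \<Rightarrow> ennreal" and c
  show "jump_op T K J Y (\<lambda>c. \<Sum>n. F n c) c = (\<Sum>n. jump_op T K J Y (F n) c)"
  proof (cases "c \<in> K")
    case True
    have "(\<Sum>j\<in>J. ennreal (Y c j) * (\<Sum>n. F n j)) = (\<Sum>n. \<Sum>j\<in>J. ennreal (Y c j) * F n j)"
      by (subst suminf_sum) simp_all
    then show ?thesis using True by (simp add: jump_op_def pos_lin_suminf[OF T] suminf_add)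
  qed (simp add: jump_op_def pos_lin_suminf[OF T])
qed

locale jump_system =
  fixes T :: "('s \<Rightarrow> ennreal) \<Rightarrow> 's \<Rightarrow> ennreal" and g :: "'s \<Rightarrow> ennreal" and K J :: "'s set"
  assumes T: "pos_lin T" and fin: "finite K" "finite J"
    and sub: "\<And>c. g c + T (\<lambda>_. 1) c \<le> 1"
    and K0: "\<And>c. c \<in> K \<Longrightarrow> g c = 0" "\<And>F c. c \<in> K \<Longrightarrow> T F c = 0"
begin

definition substoch :: "('s \<Rightarrow> 's \<Rightarrow> real) \<Rightarrow> bool" where
  "substoch Y \<longleftrightarrow> (\<forall>c\<in>K. (\<forall>j\<in>J. 0 \<le> Y c j) \<and> (\<Sum>j\<in>J. Y c j) \<le> 1)"

lemma sum_ennreal_substoch: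
  assumes "substoch Y" "c \<in> K"
  shows "(\<Sum>j\<in>J. ennreal (Y c j)) = ennreal (\<Sum>j\<in>J. Y c j)" "ennreal (\<Sum>j\<in>J. Y c j) \<le> 1"
  using assms by (auto simp: substoch_def)

lemma jump_op_sub:
  assumes "substoch Y"
  shows "g c + jump_op T K J Y (\<lambda>_. 1) c \<le> 1"
proof (cases "c \<in> K")
  case True
  then show ?thesis
    using sum_ennreal_substoch[OF assms True] K0(1) K0(2)[OF True] by (simp add: jump_op_def)
qed (simp add: jump_op_def sub)

lemma star_jump_op_le_1: "substoch Y \<Longrightarrow> star (jump_op T K J Y) g c \<le> 1"
  by (rule star_least[OF pos_lin_jump_op[OF T] jump_op_sub])

text \<open>Hybrid argument: rows of \<open>Y'\<close> are replaced by rows of \<open>Y\<close> one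
  at a time, each at the cost of a factor \<open>\<beta>\<^sup>2\<close>. Domination of
  \<open>Y\<close> by \<open>Y'\<close> is purely multiplicative; the additive error in the other
  direction is covered by the loss of the row.\<close>

lemma star_jump_op_ratio:
  fixes \<beta> \<theta> :: real
  assumes Y: "substoch Y" "substoch Y'" and \<beta>: "1 \<le> \<beta>" and \<theta>: "0 \<le> \<theta>"
    and close: "\<And>c j. c \<in> K \<Longrightarrow> j \<in> J \<Longrightarrow> Y c j \<le> \<beta> * Y' c j"
      "\<And>c j. c \<in> K \<Longrightarrow> j \<in> J \<Longrightarrow> Y' c j \<le> \<beta> * Y c j + \<theta>"
      "\<And>c. c \<in> K \<Longrightarrow> 1 - (\<Sum>j\<in>J. Y' c j) + card J * \<theta> \<le> \<beta> * (1 - (\<Sum>j\<in>J. Y c j))"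
  shows "star (jump_op T K J Y) g c \<le> ennreal (\<beta> ^ (2 * card K)) * star (jump_op T K J Y') g c"
proof -
  define Z where "Z R c = (if c \<in> R then Y c else Y' c)" for R c
  have Z: "substoch (Z R)" for R using Y by (auto simp: substoch_def Z_def)
  have "star (jump_op T K J (Z R)) g c \<le>
      ennreal (\<beta> ^ (2 * card R)) * star (jump_op T K J Y') g c" if "finite R" "R \<subseteq> K" for R
    using that
  proof (induction R)
    case empty
    have "Z {} = Y'" by (simp add: Z_def fun_eq_iff)
    then show ?case by simp
  next
    case (insert k R)
    then have k: "k \<in> K" by simp
    have "star (jump_op T K J (Z (insert k R))) g c
        \<le> (ennreal \<beta>)\<^sup>2 * star (jump_op T K J (Z R)) g c"
    proof (rule star_change_row[where k = k and \<theta> = "ennreal \<theta>" and J = J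
          and y = "\<lambda>j. ennreal (Y' k j)" and z = "ennreal (1 - (\<Sum>j\<in>J. Y' k j))"
          and y' = "\<lambda>j. ennreal (Y k j)" and z' = "ennreal (1 - (\<Sum>j\<in>J. Y k j))"])
      show "pos_lin (jump_op T K J (Z R))" "pos_lin (jump_op T K J (Z (insert k R)))"
        by (rule pos_lin_jump_op[OF T])+
      show "g c + jump_op T K J (Z R) (\<lambda>_. 1) c \<le> 1" for c by (rule jump_op_sub[OF Z])
      show "jump_op T K J (Z (insert k R)) F c = jump_op T K J (Z R) F c" if "c \<noteq> k" for F c
        using that by (simp add: jump_op_def Z_def)
      show "g k = 0" by (rule K0(1)[OF k])
      show "1 \<le> ennreal \<beta>" using \<beta> by simp
      show "jump_op T K J (Z R) F k = (\<Sum>j\<in>J. ennreal (Y' k j) * F j)" for F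
        using insert.hyps k K0(2) by (simp add: jump_op_def Z_def)
      show "jump_op T K J (Z (insert k R)) F k = (\<Sum>j\<in>J. ennreal (Y k j) * F j)" for F
        using k K0(2) by (simp add: jump_op_def Z_def)
      have Yk: "(\<Sum>j\<in>J. Y k j) \<le> 1" "(\<Sum>j\<in>J. Y' k j) \<le> 1"
          "0 \<le> (\<Sum>j\<in>J. Y k j)" "0 \<le> (\<Sum>j\<in>J. Y' k j)"
          "\<And>j. j \<in> J \<Longrightarrow> 0 \<le> Y k j" "\<And>j. j \<in> J \<Longrightarrow> 0 \<le> Y' k j"
        using Y k by (auto simp: substoch_def intro: sum_nonneg)
      show "(\<Sum>j\<in>J. ennreal (Y' k j)) + ennreal (1 - (\<Sum>j\<in>J. Y' k j)) = 1"
          "(\<Sum>j\<in>J. ennreal (Y k j)) + ennreal (1 - (\<Sum>j\<in>J. Y k j)) = 1"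
        using Yk Y k by (simp_all add: sum_ennreal_substoch flip: ennreal_plus)
      show "ennreal (Y k j) \<le> ennreal \<beta> * ennreal (Y' k j)" if "j \<in> J" for j
        using close(1)[OF k that] \<beta> by (simp add: ennreal_leI flip: ennreal_mult')
      show "ennreal (Y' k j) \<le> ennreal \<beta> * ennreal (Y k j) + ennreal \<theta>" if "j \<in> J" for j
        using close(2)[OF k that] \<beta> \<theta> Yk(5)[OF that]
        by (simp add: ennreal_leI flip: ennreal_mult' ennreal_plus)
      show "ennreal (1 - (\<Sum>j\<in>J. Y' k j)) + of_nat (card J) * ennreal \<theta>
          \<le> ennreal \<beta> * ennreal (1 - (\<Sum>j\<in>J. Y k j))"
        using close(3)[OF k] \<beta> \<theta> Yk
        by (simp add: ennreal_leI ennreal_of_nat_eq_real_of_nat flip: ennreal_mult' ennreal_plus)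
    qed
    also have "\<dots> \<le> (ennreal \<beta>)\<^sup>2 * (ennreal (\<beta> ^ (2 * card R)) * star (jump_op T K J Y') g c)"
      using insert by (intro mult_left_mono) auto
    also have "\<dots> = ennreal (\<beta> ^ (2 * card (insert k R))) * star (jump_op T K J Y') g c"
      using insert.hyps \<beta>
      by (simp add: ennreal_mult' ennreal_power power_add power2_eq_square mult.assoc)
    finally show ?case .
  qed
  from this[OF fin(1) order_refl] have
    "star (jump_op T K J (Z K)) g c \<le> ennreal (\<beta> ^ (2 * card K)) * star (jump_op T K J Y') g c" .
  moreover have "jump_op T K J (Z K) = jump_op T K J Y"
    by (auto simp: jump_op_def Z_def fun_eq_iff)
  ultimately show ?thesis by simp
qed

text \<open>Each visit to \<open>K\<close> loses mass at most \<open>\<delta>\<close>, and lost mass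
  was worth at most 1 per unit, so the damage is at most \<open>\<delta>\<close> times the expected
  number of visits. The right-hand side is a supersolution for \<open>Y\<close>.\<close>

lemma star_jump_op_truncate:
  fixes \<delta> :: real
  assumes Y: "substoch Y" "substoch Z" and le: "\<And>c j. c \<in> K \<Longrightarrow> j \<in> J \<Longrightarrow> Z c j \<le> Y c j"
    and loss: "\<And>c. c \<in> K \<Longrightarrow> (\<Sum>j\<in>J. Y c j - Z c j) \<le> \<delta>" and \<delta>: "0 \<le> \<delta>"
  shows "star (jump_op T K J Y) g c \<le> star (jump_op T K J Z) g c
    + ennreal \<delta> * star (jump_op T K J Y) (indicator K) c"
proof -
  let ?V = "star (jump_op T K J Z) g" and ?\<tau> = "star (jump_op T K J Y) (indicator K)"
  note lin = pos_lin_jump_op[OF T]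
  show ?thesis
  proof (rule star_least[OF lin])
    fix c
    have "g c + jump_op T K J Y (\<lambda>c. ?V c + ennreal \<delta> * ?\<tau> c) c
        = (g c + jump_op T K J Y ?V c) + ennreal \<delta> * jump_op T K J Y ?\<tau> c"
      by (simp only: pos_lin_add[OF lin] pos_lin_cmult[OF lin] add.assoc)
    also have "g c + jump_op T K J Y ?V c \<le> ?V c + ennreal \<delta> * indicator K c"
    proof (cases "c \<in> K")
      case True
      have row: "g c + jump_op T K J W F c = (\<Sum>j\<in>J. ennreal (W c j) * F j)" for W F
        using True K0 by (simp add: jump_op_def)
      have nn: "0 \<le> Z c j" "0 \<le> Y c j - Z c j" if "j \<in> J" for j
        using Y True that le by (auto simp: substoch_def)
      have "ennreal (Y c j) * ?V j \<le> ennreal (Z c j) * ?V j + ennreal (Y c j - Z c j)"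
        if "j \<in> J" for j
      proof -
        have "ennreal (Y c j) = ennreal (Z c j) + ennreal (Y c j - Z c j)"
          using nn[OF that] by (simp flip: ennreal_plus)
        then have "ennreal (Y c j) * ?V j = ennreal (Z c j) * ?V j + ennreal (Y c j - Z c j) * ?V j"
          by (simp add: distrib_right)
        also have "\<dots> \<le> ennreal (Z c j) * ?V j + ennreal (Y c j - Z c j) * 1"
          by (intro add_left_mono mult_left_mono star_jump_op_le_1 Y) simp
        finally show ?thesis by simp
      qed
      then have "(\<Sum>j\<in>J. ennreal (Y c j) * ?V j)
          \<le> (\<Sum>j\<in>J. ennreal (Z c j) * ?V j + ennreal (Y c j - Z c j))" by (rule sum_mono)
      also have "\<dots> = (\<Sum>j\<in>J. ennreal (Z c j) * ?V j) + ennreal (\<Sum>j\<in>J. Y c j - Z c j)"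
        using nn by (simp add: sum.distrib sum_ennreal)
      also have "\<dots> \<le> (\<Sum>j\<in>J. ennreal (Z c j) * ?V j) + ennreal \<delta>"
        by (intro add_left_mono ennreal_leI loss True)
      also have "(\<Sum>j\<in>J. ennreal (Z c j) * ?V j) = ?V c"
        using star_unfold[OF lin, of K J Z g c] by (simp only: row)
      finally show ?thesis using True by (simp add: row)
    next
      case False
      then show ?thesis
        using star_unfold[OF lin, of K J Z g c] by (simp add: jump_op_def)
    qed
    also have "?V c + ennreal \<delta> * indicator K c + ennreal \<delta> * jump_op T K J Y ?\<tau> c
        = ?V c + ennreal \<delta> * (indicator K c + jump_op T K J Y ?\<tau> c)"
      by (simp only: distrib_left add.assoc)
    also have "\<dots> = ?V c + ennreal \<delta> * ?\<tau> c" by (simp only: star_unfold[OF lin, symmetric])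
    finally show "g c + jump_op T K J Y (\<lambda>c. ?V c + ennreal \<delta> * ?\<tau> c) c
        \<le> ?V c + ennreal \<delta> * ?\<tau> c" by (simp add: add_right_mono)
  qed
qed

text \<open>An intermediate matrix \<open>Z\<close> below \<open>Y\<close> separates the two kinds
  of error: passing from \<open>Y\<close> to \<open>Z\<close> costs an amount per visit to
  \<open>K\<close>, passing from \<open>Z\<close> to \<open>Y'\<close> only a factor.\<close>

lemma star_jump_op_close:
  fixes \<beta> \<theta> :: real
  assumes Y: "substoch Y" "substoch Y'" and \<beta>: "1 \<le> \<beta>" "\<beta> \<le> 2" and \<theta>: "0 \<le> \<theta>"
    and \<kappa>: "\<kappa> = (card J + 1) * \<theta>" "\<kappa> < 1"
    and close: "\<And>c j. c \<in> K \<Longrightarrow> j \<in> J \<Longrightarrow> Y c j \<le> \<beta> * (Y' c j + \<theta>)"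
      "\<And>c j. c \<in> K \<Longrightarrow> j \<in> J \<Longrightarrow> Y' c j \<le> \<beta> * (Y c j + \<theta>)"
      "\<And>c. c \<in> K \<Longrightarrow> 1 - (\<Sum>j\<in>J. Y' c j) \<le> \<beta> * (1 - (\<Sum>j\<in>J. Y c j) + \<theta>)"
  shows "star (jump_op T K J Y) g c \<le>
      ennreal ((\<beta> / (1 - \<kappa>)) ^ (2 * card K)) * star (jump_op T K J Y') g c
      + ennreal (3 * \<kappa>) * star (jump_op T K J Y) (indicator K) c"
proof -
  \<comment> \<open>The minimum removes the additive error from the comparison with
    \<open>\<beta> * Y'\<close>; the factor \<open>1 - \<kappa>\<close> forces a loss of at least
    \<open>\<kappa>\<close> in every row, which makes room for the slacks of the entries.\<close>
  define Z where "Z c j = (1 - \<kappa>) * min (Y c j) (\<beta> * Y' c j)" for c j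
  have \<kappa>0: "0 \<le> \<kappa>" using \<kappa> \<theta> by simp
  have "\<beta> * (1 - \<kappa>) \<le> \<beta> * 1" using \<kappa>0 \<beta> by (intro mult_left_mono) auto
  then have \<beta>_le: "\<beta> \<le> \<beta> / (1 - \<kappa>)" using \<kappa>(2) by (simp add: pos_le_divide_eq)
  have Ynn: "0 \<le> Y c j" "0 \<le> Y' c j" if "c \<in> K" "j \<in> J" for c j
    using Y that by (auto simp: substoch_def)
  have Znn: "0 \<le> Z c j" if "c \<in> K" "j \<in> J" for c j
    using Ynn[OF that] \<beta> \<kappa> by (simp add: Z_def)
  have min_le: "Z c j \<le> (1 - \<kappa>) * Y c j" for c j
    using \<kappa> by (simp add: Z_def mult_left_mono)
  have ZY: "Z c j \<le> Y c j" if "c \<in> K" "j \<in> J" for c j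
    using min_le[of c j] Ynn[OF that] \<kappa>0 mult_right_mono[of "1 - \<kappa>" 1 "Y c j"] by simp
  have Z: "substoch Z"
    using Y(1) sum_mono[of J "Z _" "Y _", OF ZY] Znn
    by (auto simp: substoch_def intro: order_trans)
  have "star (jump_op T K J Z) g c
      \<le> ennreal ((\<beta> / (1 - \<kappa>)) ^ (2 * card K)) * star (jump_op T K J Y') g c"
  proof (rule star_jump_op_ratio[OF Z Y(2), where \<theta> = "\<beta> * \<theta>"])
    show "1 \<le> \<beta> / (1 - \<kappa>)" using \<beta> \<beta>_le by simp
    show "0 \<le> \<beta> * \<theta>" using \<beta> \<theta> by simp
    fix c assume c: "c \<in> K"
    show "Z c j \<le> \<beta> / (1 - \<kappa>) * Y' c j" if "j \<in> J" for j
    proof -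
      have "Z c j \<le> (1 - \<kappa>) * (\<beta> * Y' c j)" using \<kappa> by (simp add: Z_def mult_left_mono)
      also have "\<dots> \<le> 1 * (\<beta> * Y' c j)"
        using \<kappa>0 \<beta> Ynn[OF c that] by (intro mult_right_mono) auto
      also have "\<dots> \<le> \<beta> / (1 - \<kappa>) * Y' c j"
        using mult_right_mono[OF \<beta>_le, of "Y' c j"] Ynn[OF c that] by simp
      finally show ?thesis .
    qed
    show "Y' c j \<le> \<beta> / (1 - \<kappa>) * Z c j + \<beta> * \<theta>" if "j \<in> J" for j
    proof -
      have "\<beta> / (1 - \<kappa>) * Z c j = \<beta> * min (Y c j) (\<beta> * Y' c j)" using \<kappa> by (simp add: Z_def)
      moreover have "Y' c j \<le> \<beta> * (\<beta> * Y' c j)"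
        using \<beta> Ynn[OF c that] mult_mono[of 1 \<beta> "Y' c j" "\<beta> * Y' c j"]
          mult_right_mono[of 1 \<beta> "Y' c j"] by simp
      moreover have "0 \<le> \<beta> * \<theta>" using \<beta> \<theta> by simp
      ultimately show ?thesis using close(2)[OF c that]
        by (simp add: min_def distrib_left)
    qed
    have "(\<Sum>j\<in>J. Z c j) \<le> (1 - \<kappa>) * (\<Sum>j\<in>J. Y c j)"
      unfolding sum_distrib_left by (intro sum_mono min_le)
    then have "1 - (1 - \<kappa>) * (\<Sum>j\<in>J. Y c j) \<le> 1 - (\<Sum>j\<in>J. Z c j)" by simp
    then have "\<beta> / (1 - \<kappa>) * (1 - (1 - \<kappa>) * (\<Sum>j\<in>J. Y c j)) \<le> \<beta> / (1 - \<kappa>) * (1 - (\<Sum>j\<in>J. Z c j))"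
      using \<beta> \<kappa> by (intro mult_left_mono) auto
    moreover have "\<beta> / (1 - \<kappa>) * (1 - (1 - \<kappa>) * (\<Sum>j\<in>J. Y c j))
        = \<beta> / (1 - \<kappa>) - \<beta> * (\<Sum>j\<in>J. Y c j)"
      using \<kappa> by (simp add: field_simps)
    moreover have "\<beta> * (1 + \<kappa>) \<le> \<beta> / (1 - \<kappa>)"
    proof -
      have "(1 + \<kappa>) * (1 - \<kappa>) \<le> 1" by (simp add: algebra_simps)
      then have "1 + \<kappa> \<le> 1 / (1 - \<kappa>)" using \<kappa> by (simp add: field_simps)
      then show ?thesis using mult_left_mono[of "1 + \<kappa>" "1 / (1 - \<kappa>)" \<beta>] \<beta> by simp
    qed
    \<comment> \<open>The \<open>card J\<close> slacks and the one in the loss hypothesis add up to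
      \<open>\<kappa>\<close>, whence the \<open>+ 1\<close> in its definition.\<close>
    moreover have "1 - (\<Sum>j\<in>J. Y' c j) + card J * (\<beta> * \<theta>)
        \<le> \<beta> * (1 + \<kappa>) - \<beta> * (\<Sum>j\<in>J. Y c j)"
      using close(3)[OF c] by (simp add: \<kappa>(1) algebra_simps)
    ultimately show "1 - (\<Sum>j\<in>J. Y' c j) + card J * (\<beta> * \<theta>)
        \<le> \<beta> / (1 - \<kappa>) * (1 - (\<Sum>j\<in>J. Z c j))" by linarith
  qed
  moreover have "star (jump_op T K J Y) g c \<le> star (jump_op T K J Z) g c
      + ennreal (3 * \<kappa>) * star (jump_op T K J Y) (indicator K) c"
  proof (rule star_jump_op_truncate[OF Y(1) Z])
    show "Z c j \<le> Y c j" if "c \<in> K" "j \<in> J" for c j by (rule ZY[OF that])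
    show "0 \<le> 3 * \<kappa>" using \<kappa>0 by simp
    fix c assume c: "c \<in> K"
    have "Y c j - Z c j \<le> \<kappa> * Y c j + \<beta> * \<theta>" if "j \<in> J" for j
    proof -
      let ?m = "min (Y c j) (\<beta> * Y' c j)"
      have "0 \<le> \<beta> * \<theta>" using \<beta> \<theta> by simp
      then have "Y c j - ?m \<le> \<beta> * \<theta>" using close(1)[OF c that] by (simp add: min_def distrib_left)
      moreover have "\<kappa> * ?m \<le> \<kappa> * Y c j" using \<kappa>0 by (simp add: mult_left_mono)
      ultimately show ?thesis by (simp add: Z_def left_diff_distrib)
    qed
    then have "(\<Sum>j\<in>J. Y c j - Z c j) \<le> (\<Sum>j\<in>J. \<kappa> * Y c j + \<beta> * \<theta>)" by (rule sum_mono)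
    also have "\<dots> = \<kappa> * (\<Sum>j\<in>J. Y c j) + \<beta> * (card J * \<theta>)"
      by (simp add: sum.distrib sum_distrib_left)
    \<comment> \<open>The factor 3: one \<open>\<kappa>\<close> for the scaling by
      \<open>1 - \<kappa>\<close> and, as \<open>\<beta> \<le> 2\<close>, at most two more for the
      minimum.\<close>
    also have "\<dots> \<le> \<kappa> * 1 + 2 * (card J * \<theta>)"
      using Y(1) c \<kappa>0 \<beta> \<theta> by (intro add_mono mult_left_mono mult_right_mono) (auto simp: substoch_def)
    also have "\<dots> \<le> 3 * \<kappa>" using \<theta> by (simp add: \<kappa>(1) algebra_simps)
    finally show "(\<Sum>j\<in>J. Y c j - Z c j) \<le> 3 * \<kappa>" .
  qed
  ultimately show ?thesis by (meson add_right_mono order_trans)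
qed

end

section \<open>Crossing probabilities of a two-way automaton\<close>

text \<open>Halting configurations are killed rather than absorbing, so that \<open>star\<close>
  counts each halting computation once.\<close>

definition chain :: "('q, 'a) tpfa \<Rightarrow> 'a list \<Rightarrow> ('q \<times> int \<Rightarrow> ennreal) \<Rightarrow> 'q \<times> int \<Rightarrow> ennreal" where
  "chain A w F c = (if fst c \<in> halting A then 0 else \<integral>\<^sup>+ x. F x \<partial>step A w c)"

text \<open>The test is phrased as set membership to fit \<open>pos_lin_restrict\<close>.
  Configurations beyond cell \<open>k\<close> are dead ends, to be filled in by jumps.\<close>

definition left_chain :: "('q, 'a) tpfa \<Rightarrow> 'a list \<Rightarrow> int \<Rightarrow> ('q \<times> int \<Rightarrow> ennreal) \<Rightarrow> 'q \<times> int \<Rightarrow> ennreal" where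
  "left_chain A w k F c = (if c \<in> {c. snd c \<le> k} then chain A w F c else 0)"

definition right_chain :: "('q, 'a) tpfa \<Rightarrow> 'a list \<Rightarrow> int \<Rightarrow> ('q \<times> int \<Rightarrow> ennreal) \<Rightarrow> 'q \<times> int \<Rightarrow> ennreal" where
  "right_chain A w k F c = (if c \<in> {c. k < snd c} then chain A w F c else 0)"

definition exit_ind :: "('q, 'a) tpfa \<Rightarrow> int \<Rightarrow> 'q \<Rightarrow> 'q \<times> int \<Rightarrow> ennreal" where
  "exit_ind A k q c = (if fst c = q \<and> (snd c = k \<or> k < snd c \<and> q \<in> halting A) then 1 else 0)"

text \<open>The probability that the computation entering the cells to the right of cell \<open>k\<close> in state
  \<open>q\<close> leaves them in state \<open>q'\<close> or halts inside them in state \<open>q'\<close>. Merging the two events is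
  harmless, because a halting state has the same value wherever the head stands.\<close>

definition crossing :: "('q, 'a) tpfa \<Rightarrow> 'a list \<Rightarrow> int \<Rightarrow> 'q \<Rightarrow> 'q \<Rightarrow> ennreal" where
  "crossing A w k q q' = star (right_chain A w k) (exit_ind A k q') (q, k + 1)"

lemma pos_lin_chain: "pos_lin (chain A w)"
  unfolding pos_lin_def chain_def[abs_def]
  by (auto simp: fun_eq_iff nn_integral_add nn_integral_cmult nn_integral_suminf)

lemma pos_lin_left: "pos_lin (left_chain A w k)"
  unfolding left_chain_def[abs_def] by (rule pos_lin_restrict[OF pos_lin_chain])

lemma pos_lin_right: "pos_lin (right_chain A w k)"
  unfolding right_chain_def[abs_def] by (rule pos_lin_restrict[OF pos_lin_chain])

section \<open>Halting probabilities and running time as values of \<open>star\<close>\<close>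

lemma chain_one: "chain A w (\<lambda>_. 1) c = (if fst c \<in> halting A then 0 else 1)"
  by (simp add: chain_def measure_pmf.emeasure_space_1[simplified])

text \<open>Duality between forward distributions and the backward operator; \<open>None\<close> is
  worth 0, which matches the killing in \<open>chain\<close>. The function stays general because the
  induction peels off the last step.\<close>

lemma nn_integral_run:
  "(\<integral>\<^sup>+ x. (case x of None \<Rightarrow> 0 | Some c \<Rightarrow> F c) \<partial>run A w t) = (chain A w ^^ t) F (start A, 0)"
proof (induction t arbitrary: F)
  case (Suc t)
  have "(\<integral>\<^sup>+ x. (case x of None \<Rightarrow> 0 | Some c \<Rightarrow> F c) \<partial>run A w (Suc t))
      = (\<integral>\<^sup>+ x. (case x of None \<Rightarrow> 0 | Some c \<Rightarrow> chain A w F c) \<partial>run A w t)"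
    unfolding run.simps nn_integral_bind_pmf
    by (intro nn_integral_cong) (auto simp: chain_def split: option.split)
  then show ?case using Suc by (simp add: funpow_swap1)
qed simp

lemma prob_halts_at_eq:
  "prob_halts_at A F w t = (chain A w ^^ t) (indicator {c. fst c \<in> F \<inter> halting A}) (start A, 0)"
proof -
  have "prob_halts_at A F w t
      = (\<integral>\<^sup>+ x. indicator {Some (q, i) |q i. q \<in> F \<inter> halting A} x \<partial>run A w t)"
    by (simp add: prob_halts_at_def)
  also have "\<dots> = (\<integral>\<^sup>+ x. (case x of None \<Rightarrow> 0
      | Some c \<Rightarrow> indicator {c. fst c \<in> F \<inter> halting A} c) \<partial>run A w t)"
    by (intro nn_integral_cong) (auto simp: indicator_def split: option.split)
  finally show ?thesis by (simp only: nn_integral_run)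
qed

lemma prob_accepts_eq:
  "prob_accepts A w = star (chain A w) (indicator {c. fst c \<in> accepting A}) (start A, 0)"
proof -
  have "accepting A \<inter> halting A = accepting A" by (auto simp: halting_def)
  then show ?thesis by (simp add: prob_accepts_def star_def prob_halts_at_eq)
qed

lemma prob_rejects_eq:
  "prob_rejects A w = star (chain A w) (indicator {c. fst c \<in> rejecting A}) (start A, 0)"
proof -
  have "rejecting A \<inter> halting A = rejecting A" by (auto simp: halting_def)
  then show ?thesis by (simp add: prob_rejects_def star_def prob_halts_at_eq)
qed

text \<open>The constant 1 is a supersolution: a halting state pays at most 1 and stops, any other
  state pays nothing and passes on mass 1.\<close>

lemma prob_accepts_plus_rejects:
  assumes "accepting A \<inter> rejecting A = {}"
  shows "prob_accepts A w + prob_rejects A w \<le> 1"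
  unfolding prob_accepts_eq prob_rejects_eq star_add[OF pos_lin_chain, symmetric]
proof (rule star_least[OF pos_lin_chain])
  fix c :: "'a \<times> int"
  show "indicator {c. fst c \<in> accepting A} c + indicator {c. fst c \<in> rejecting A} c
      + chain A w (\<lambda>_. 1) c \<le> 1"
    using assms by (auto simp: chain_one halting_def indicator_def)
qed

text \<open>The series adds up the probabilities of no halt before step \<open>t\<close>. By the
  tail-sum formula this is the expected running time plus 1, the 1 coming from step 0.\<close>

lemma star_one_le_expected_steps:
  "star (chain A w) (\<lambda>_. 1) (start A, 0) \<le> expected_steps A w + 1"
proof -
  let ?c = "(start A, 0) :: _ \<times> int" and ?T = "chain A w"
  define h s where "h t = prob_halts_at A (halting A) w t" and "s t = (?T ^^ t) (\<lambda>_. 1) ?c" for t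
  have h: "h t = (?T ^^ t) (indicator {c. fst c \<in> halting A}) ?c" for t
    by (simp add: h_def prob_halts_at_eq)
  have one: "(\<lambda>_. 1) = (\<lambda>c. indicator {c. fst c \<in> halting A} c + ?T (\<lambda>_. 1) c)"
    by (auto simp: fun_eq_iff chain_one indicator_def)
  have step: "s t = h t + s (Suc t)" for t
  proof -
    have "s t = (?T ^^ t) (\<lambda>c. indicator {c. fst c \<in> halting A} c + ?T (\<lambda>_. 1) c) ?c"
      unfolding s_def using one by simp
    also have "\<dots> = h t + (?T ^^ t) (?T (\<lambda>_. 1)) ?c"
      unfolding h using pos_lin_add[OF pos_lin_pow[OF pos_lin_chain]] by metis
    finally show ?thesis by (simp add: s_def funpow_swap1)
  qed
  have part: "(\<Sum>u<t. h u) + s t = 1" for t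
  proof (induction t)
    case (Suc t)
    then show ?case using step[of t] by (simp add: add.assoc)
  qed (simp add: s_def)
  have le1: "(\<Sum>u. h u) \<le> 1"
  proof (rule suminf_le_const)
    show "(\<Sum>u<t. h u) \<le> 1" for t using part[of t] by (metis le_iff_add)
  qed simp
  show ?thesis
  proof (cases "expected_steps A w = \<infinity>")
    case False
    \<comment> \<open>A finite expectation kills the second summand of
      \<open>expected_steps\<close>, so halting is almost sure and \<open>s t\<close> is a tail of
      the series of \<open>h\<close>.\<close>
    then have "1 - (\<Sum>t. h t) = 0"
      by (auto simp: expected_steps_def h_def[abs_def] ennreal_top_mult split: if_splits)
    then have sum1: "(\<Sum>t. h t) = 1" using le1 by (simp add: diff_eq_0_iff_ennreal)
    have tail: "s t \<le> (\<Sum>u. if t \<le> u then h u else 0)" for t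
    proof -
      have "(\<Sum>u<t. h u) = (\<Sum>u. if u < t then h u else 0)"
        using suminf_finite[of "{..<t}" "\<lambda>u. if u < t then h u else 0"] by simp
      moreover have "(\<Sum>u. h u) = (\<Sum>u. (if u < t then h u else 0) + (if t \<le> u then h u else 0))"
        by (intro suminf_cong) auto
      ultimately have "(\<Sum>u. h u) = (\<Sum>u<t. h u) + (\<Sum>u. if t \<le> u then h u else 0)"
        by (simp add: suminf_add)
      then have "(\<Sum>u<t. h u) + s t = (\<Sum>u<t. h u) + (\<Sum>u. if t \<le> u then h u else 0)"
        using part[of t] sum1 by simp
      moreover have "(\<Sum>u<t. h u) \<le> 1" using part[of t] by (metis le_iff_add)
      then have "(\<Sum>u<t. h u) \<noteq> \<infinity>"
        using neq_top_trans[OF ennreal_one_neq_top] by simp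
      ultimately show ?thesis by (simp add: ennreal_add_left_cancel)
    qed
    have "star ?T (\<lambda>_. 1) ?c = (\<Sum>t. s t)" by (simp add: star_def s_def)
    also have "\<dots> \<le> (\<Sum>t. \<Sum>u. if t \<le> u then h u else 0)"
      by (intro suminf_le tail) auto
    \<comment> \<open>The double series is exchanged by reading the inner sum as an integral over
      counting measure.\<close>
    also have "\<dots> = (\<Sum>t. \<integral>\<^sup>+ u. (if t \<le> u then h u else 0) \<partial>count_space UNIV)"
      by (simp add: nn_integral_count_space_nat)
    also have "\<dots> = (\<integral>\<^sup>+ u. (\<Sum>t. if t \<le> u then h u else 0) \<partial>count_space UNIV)"
      by (rule nn_integral_suminf[symmetric]) simp
    also have "\<dots> = (\<Sum>u. \<Sum>t. if t \<le> u then h u else 0)"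
      by (simp add: nn_integral_count_space_nat)
    also have "\<dots> = (\<Sum>u. of_nat u * h u + h u)"
    proof (rule suminf_cong)
      fix u
      have "(\<Sum>t. if t \<le> u then h u else 0) = (\<Sum>t\<le>u. if t \<le> u then h u else 0)"
        by (rule suminf_finite) auto
      also have "\<dots> = of_nat (Suc u) * h u" by simp
      finally show "(\<Sum>t. if t \<le> u then h u else 0) = of_nat u * h u + h u"
        by (simp add: distrib_right add.commute)
    qed
    also have "\<dots> = (\<Sum>u. of_nat u * h u) + 1" using sum1 by (simp add: suminf_add[symmetric])
    also have "\<dots> \<le> expected_steps A w + 1"
      by (simp add: expected_steps_def h_def[abs_def])
    finally show ?thesis .
  qed simp
qed

lemma tape_cases:
  assumes "w \<in> lists \<Sigma>"
  shows "tape w i \<in> {Left_End, Right_End} \<union> Letter ` \<Sigma>"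
proof -
  have "w ! nat (i - 1) \<in> \<Sigma>" if "0 < i" "i \<le> int (length w)"
    using assms that nth_mem[of "nat (i - 1)" w] by auto
  then show ?thesis by (auto simp: tape_def)
qed

lemma set_pmf_step:
  assumes A: "is_2pfa \<Sigma> A" and w: "w \<in> lists \<Sigma>"
    and c: "fst c \<in> states A" "fst c \<notin> halting A" "0 \<le> snd c" "snd c \<le> int (length w) + 1"
    and x: "x \<in> set_pmf (step A w c)"
  shows "fst x \<in> states A" "0 \<le> snd x" "snd x \<le> int (length w) + 1"
    "snd c - 1 \<le> snd x" "snd x \<le> snd c + 1"
proof -
  obtain q i where ci: "c = (q, i)" by (cases c)
  obtain q' d where d: "(q', d) \<in> set_pmf (delta A q (tape w i))" "x = (q', i + d)"
    using x by (auto simp: step_def ci)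
  have q: "q \<in> states A - halting A" using c(1,2) ci by simp
  have "\<forall>q \<in> states A - halting A. \<forall>s \<in> {Left_End, Right_End} \<union> Letter ` \<Sigma>.
      \<forall>(q', d) \<in> set_pmf (delta A q s). q' \<in> states A \<and> d \<in> {-1, 0, 1} \<and>
      (s = Left_End \<longrightarrow> d \<noteq> -1) \<and> (s = Right_End \<longrightarrow> d \<noteq> 1)"
    using A unfolding is_2pfa_def by (elim conjE)
  from bspec[OF bspec[OF bspec[OF this q] tape_cases[OF w, of i]] d(1)]
  have *: "q' \<in> states A" "d \<in> {-1, 0, 1}"
      "tape w i = Left_End \<longrightarrow> d \<noteq> -1" "tape w i = Right_End \<longrightarrow> d \<noteq> 1" by auto
  have "i \<noteq> 0" if "d = -1" using *(3) that by (auto simp: tape_def)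
  moreover have "i \<noteq> int (length w) + 1" if "d = 1" using *(4) that by (auto simp: tape_def)
  ultimately show "fst x \<in> states A" "0 \<le> snd x" "snd x \<le> int (length w) + 1"
      "snd c - 1 \<le> snd x" "snd x \<le> snd c + 1"
    using *(1,2) c(3,4) unfolding d(2) ci by force+
qed

lemma chain_cong:
  assumes "\<And>x. x \<in> set_pmf (step A w c) \<Longrightarrow> fst c \<notin> halting A \<Longrightarrow> F x = G x"
  shows "chain A w F c = chain A w G c"
  using assms by (auto simp: chain_def intro!: nn_integral_cong_AE AE_pmfI)

section \<open>The jump system of a cut behind cell \<open>k\<close>\<close>

definition entries :: "('q, 'a) tpfa \<Rightarrow> int \<Rightarrow> ('q \<times> int) set" where
  "entries A k = (\<lambda>q. (q, k + 1)) ` states A"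

definition exits :: "('q, 'a) tpfa \<Rightarrow> int \<Rightarrow> ('q \<times> int) set" where
  "exits A k = (\<lambda>q. (q, k)) ` states A"

text \<open>Acceptance beyond the cut needs no reward of its own: \<open>crossing\<close> reports it
  as an exit in the accepting state at cell \<open>k\<close>, which is rewarded.\<close>

definition left_accept :: "('q, 'a) tpfa \<Rightarrow> int \<Rightarrow> 'q \<times> int \<Rightarrow> ennreal" where
  "left_accept A k = indicator {c. fst c \<in> accepting A \<and> snd c \<le> k}"

lemma card_entries: "card (entries A k) = card (states A)"
  and card_exits: "card (exits A k) = card (states A)"
  by (auto simp: entries_def exits_def intro!: card_image inj_onI)

lemma sum_exits: "(\<Sum>j\<in>exits A k. f j) = (\<Sum>q\<in>states A. f (q, k))"
  unfolding exits_def by (subst sum.reindex) (auto intro: inj_onI)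

lemma jump_system_2pfa:
  assumes "is_2pfa \<Sigma> A"
  shows "jump_system (left_chain A w k) (left_accept A k) (entries A k) (exits A k)"
proof
  show "finite (entries A k)" "finite (exits A k)"
    using assms by (auto simp: is_2pfa_def entries_def exits_def)
  show "left_accept A k c + left_chain A w k (\<lambda>_. 1) c \<le> 1" for c
    by (auto simp: left_accept_def left_chain_def chain_one indicator_def halting_def)
  show "left_accept A k c = 0" "left_chain A w k F c = 0" if "c \<in> entries A k" for c F
    using that by (auto simp: left_accept_def left_chain_def entries_def indicator_def)
qed (rule pos_lin_left)

lemma star_right_sum:
  "star (right_chain A w k) (\<lambda>c. \<Sum>q\<in>Q. F q * exit_ind A k q c) (q0, k + 1)
     = (\<Sum>q\<in>Q. crossing A w k q0 q * F q)"
  by (simp add: star_sum[OF pos_lin_right] crossing_def mult.commute)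

lemma sum_exit_ind:
  assumes "finite Q"
  shows "(\<Sum>q\<in>Q. F q * exit_ind A k q c)
    = (if fst c \<in> Q \<and> (snd c = k \<or> k < snd c \<and> fst c \<in> halting A) then F (fst c) else 0)"
proof -
  have "(\<Sum>q\<in>Q. F q * exit_ind A k q c)
      = (\<Sum>q\<in>Q. if q = fst c then (if snd c = k \<or> k < snd c \<and> q \<in> halting A then F q else 0) else 0)"
    by (intro sum.cong) (auto simp: exit_ind_def)
  then show ?thesis using assms by (simp add: sum.delta)
qed

lemma sum_crossing_le_1:
  assumes "finite Q"
  shows "(\<Sum>q\<in>Q. crossing A w k q0 q) \<le> 1"
proof -
  have "star (right_chain A w k) (\<lambda>c. \<Sum>q\<in>Q. 1 * exit_ind A k q c) (q0, k + 1) \<le> 1"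
  proof (rule star_least[OF pos_lin_right])
    fix c :: "'a \<times> int"
    show "(\<Sum>q\<in>Q. 1 * exit_ind A k q c) + right_chain A w k (\<lambda>_. 1) c \<le> 1"
      unfolding sum_exit_ind[OF assms] by (auto simp: right_chain_def chain_one)
  qed
  then show ?thesis unfolding star_right_sum by simp
qed

text \<open>\<open>u\<close> is a supersolution for the excursion to the right of the cut when an
  exit in state \<open>q\<close> pays \<open>u (q, k)\<close>. The last hypothesis covers halting
  inside, which is paid as if it had happened at cell \<open>k\<close>.\<close>

lemma crossing_le_value:
  assumes Q: "finite Q" and u: "\<And>c. chain A w u c \<le> u c"
    and halt: "\<And>q i. q \<in> halting A \<Longrightarrow> k < i \<Longrightarrow> u (q, k) \<le> u (q, i)"
  shows "star (right_chain A w k) (\<lambda>c. \<Sum>q\<in>Q. u (q, k) * exit_ind A k q c) c \<le> u c"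
proof (rule star_least[OF pos_lin_right])
  fix c :: "'a \<times> int"
  show "(\<Sum>q\<in>Q. u (q, k) * exit_ind A k q c) + right_chain A w k u c \<le> u c"
    unfolding sum_exit_ind[OF Q] using u[of c] halt[of "fst c" "snd c"]
    by (cases c) (auto simp: right_chain_def chain_def)
qed

text \<open>The true acceptance probability is a supersolution of the jump system: at entries by
  \<open>crossing_le_value\<close>, left of the cut by its own one-step equation.\<close>

lemma jump_system_value_le:
  fixes A :: "('q, 'a) tpfa"
  assumes A: "is_2pfa \<Sigma> A"
    and Y: "\<And>q q'. q \<in> states A \<Longrightarrow> q' \<in> states A \<Longrightarrow>
      ennreal (Y (q, k + 1) (q', k)) = crossing A w k q q'"
  shows "star (jump_op (left_chain A w k) (entries A k) (exits A k) Y) (left_accept A k) c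
    \<le> star (chain A w) (indicator {c. fst c \<in> accepting A}) c"
proof (rule star_least[OF pos_lin_jump_op[OF pos_lin_left]])
  fix c :: "'q \<times> int"
  let ?V = "star (chain A w) (indicator {c. fst c \<in> accepting A})"
  have unf: "?V c = indicator {c. fst c \<in> accepting A} c + chain A w ?V c" for c
    by (rule star_unfold[OF pos_lin_chain])
  have fin: "finite (states A)" using A by (simp add: is_2pfa_def)
  show "left_accept A k c + jump_op (left_chain A w k) (entries A k) (exits A k) Y ?V c \<le> ?V c"
  proof (cases "c \<in> entries A k")
    case True
    then obtain q where q: "q \<in> states A" "c = (q, k + 1)" by (auto simp: entries_def)
    have "left_accept A k c + jump_op (left_chain A w k) (entries A k) (exits A k) Y ?V c
        = (\<Sum>q'\<in>states A. crossing A w k q q' * ?V (q', k))"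
      using True q Y by (simp add: jump_op_def left_accept_def left_chain_def sum_exits)
    also have "\<dots> = star (right_chain A w k) (\<lambda>c. \<Sum>q\<in>states A. ?V (q, k) * exit_ind A k q c) c"
      unfolding q(2) star_right_sum[of A w k "\<lambda>q. ?V (q, k)"] ..
    also have "\<dots> \<le> ?V c"
    proof (rule crossing_le_value[OF fin])
      show "chain A w ?V c \<le> ?V c" for c using unf[of c] by (metis add_increasing order_refl zero_le)
      show "?V (q, k) \<le> ?V (q, i)" if "q \<in> halting A" for q i
        using unf[of "(q, k)"] unf[of "(q, i)"] that by (simp add: chain_def indicator_def)
    qed
    finally show ?thesis .
  next
    case False
    then show ?thesis
      by (subst unf) (auto simp: jump_op_def left_accept_def left_chain_def indicator_def)
  qed
qed

text \<open>Each jump accounts for a separate visit of the head to cell \<open>k + 1\<close>, so the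
  number of jumps is controlled by the running time.\<close>

lemma jump_system_visits_le:
  fixes A :: "('q, 'a) tpfa"
  assumes A: "is_2pfa \<Sigma> A"
    and Y: "\<And>q q'. q \<in> states A \<Longrightarrow> q' \<in> states A \<Longrightarrow>
      ennreal (Y (q, k + 1) (q', k)) = crossing A w k q q'"
  shows "star (jump_op (left_chain A w k) (entries A k) (exits A k) Y) (indicator (entries A k)) c
    \<le> star (chain A w) (indicator {c. snd c = k + 1}) c"
proof (rule star_least[OF pos_lin_jump_op[OF pos_lin_left]])
  fix c :: "'q \<times> int"
  let ?V = "star (chain A w) (indicator {c. snd c = k + 1})"
  have unf: "?V c = indicator {c. snd c = k + 1} c + chain A w ?V c" for c
    by (rule star_unfold[OF pos_lin_chain])
  have fin: "finite (states A)" using A by (simp add: is_2pfa_def)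
  have V: "chain A w ?V c \<le> ?V c" for c using unf[of c] by (metis add_increasing order_refl zero_le)
  show "indicator (entries A k) c + jump_op (left_chain A w k) (entries A k) (exits A k) Y ?V c \<le> ?V c"
  proof (cases "c \<in> entries A k")
    case True
    then obtain q where q: "q \<in> states A" "c = (q, k + 1)" by (auto simp: entries_def)
    define e where "e c = (\<Sum>q\<in>states A. ?V (q, k) * exit_ind A k q c)" for c
    have V0: "?V (q, k) = 0" if "q \<in> halting A" for q
      using unf[of "(q, k)"] that by (simp add: chain_def)
    have le: "star (right_chain A w k) e c \<le> ?V c" for c
      unfolding e_def[abs_def] by (rule crossing_le_value[OF fin V]) (simp add: V0)
    have "indicator (entries A k) c + jump_op (left_chain A w k) (entries A k) (exits A k) Y ?V c
        = 1 + (\<Sum>q'\<in>states A. crossing A w k q q' * ?V (q', k))"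
      using True q Y by (simp add: jump_op_def left_chain_def sum_exits)
    also have "(\<Sum>q'\<in>states A. crossing A w k q q' * ?V (q', k)) = star (right_chain A w k) e c"
      unfolding q(2) e_def[abs_def] star_right_sum[of A w k "\<lambda>q. ?V (q, k)"] ..
    \<comment> \<open>The excursion is unfolded by one step: bounding it by \<open>?V c\<close>
      directly would count the visit at its start a second time, next to the summand 1.\<close>
    also have "\<dots> = e c + right_chain A w k (star (right_chain A w k) e) c"
      by (rule star_unfold[OF pos_lin_right])
    also have "e c = 0" unfolding e_def sum_exit_ind[OF fin] using q V0 by simp
    also have "right_chain A w k (star (right_chain A w k) e) c
        = chain A w (star (right_chain A w k) e) c"
      using q by (simp add: right_chain_def)
    also have "\<dots> \<le> chain A w ?V c" by (rule pos_lin_mono[OF pos_lin_chain le])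
    also have "1 + (0 + chain A w ?V c) = ?V c" by (subst unf) (simp add: q)
    finally show ?thesis by (simp add: add_left_mono)
  next
    case False
    then show ?thesis by (subst unf) (auto simp: jump_op_def left_chain_def)
  qed
qed

text \<open>A supersolution of the full chain is glued from the value of the jump system left of the
  cut and the value of the excursion right of it. The pieces agree on cells \<open>k\<close> and
  \<open>k + 1\<close>, and the head moves at most one cell, so no step notices the seam.\<close>

lemma value_le_jump_system:
  fixes A :: "('q, 'a) tpfa"
  assumes A: "is_2pfa \<Sigma> A" and w: "w \<in> lists \<Sigma>" and k: "0 \<le> k" "k \<le> int (length w)"
    and Y: "\<And>q q'. q \<in> states A \<Longrightarrow> q' \<in> states A \<Longrightarrow>
      ennreal (Y (q, k + 1) (q', k)) = crossing A w k q q'"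
  shows "star (chain A w) (indicator {c. fst c \<in> accepting A}) (start A, 0)
    \<le> star (jump_op (left_chain A w k) (entries A k) (exits A k) Y) (left_accept A k) (start A, 0)"
proof -
  let ?T = "jump_op (left_chain A w k) (entries A k) (exits A k) Y"
  let ?V = "star ?T (left_accept A k)" and ?a = "indicator {c. fst c \<in> accepting A}"
  let ?R = "right_chain A w k"
  have fin: "finite (states A)" "start A \<in> states A" using A by (simp_all add: is_2pfa_def)
  have unf: "?V c = left_accept A k c + ?T ?V c" for c
    by (rule star_unfold[OF pos_lin_jump_op[OF pos_lin_left]])
  define e where "e c = (\<Sum>q\<in>states A. ?V (q, k) * exit_ind A k q c)" for c
  define good where "good = {c. fst c \<in> states A \<and> 0 \<le> snd c \<and> snd c \<le> int (length w) + 1}"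
  \<comment> \<open>Off the configurations that can occur, the value \<open>\<infinity>\<close> makes the inequality vacuous.\<close>
  define u where "u c = (if c \<notin> good then \<infinity> else if snd c \<le> k then ?V c else star ?R e c)" for c
  have entry: "star ?R e c = ?V c" if c: "fst c \<in> states A" "snd c = k + 1" for c
  proof -
    obtain q where q: "c = (q, k + 1)" "q \<in> states A" using c by (metis prod.collapse)
    have "star ?R e c = (\<Sum>q'\<in>states A. crossing A w k q q' * ?V (q', k))"
      unfolding q(1) e_def[abs_def] star_right_sum[of A w k "\<lambda>q. ?V (q, k)"] ..
    also have "\<dots> = ?T ?V c"
      using q Y by (simp add: jump_op_def left_chain_def sum_exits entries_def image_iff)
    finally show ?thesis using unf[of c] q by (simp add: left_accept_def)
  qed
  have exit: "star ?R e c = ?V c" if "fst c \<in> states A" "snd c = k" for c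
    using star_unfold[OF pos_lin_right, of A w k e c] that
    unfolding e_def[of c] sum_exit_ind[OF fin(1)] by (cases c) (simp add: right_chain_def)
  have "star (chain A w) ?a (start A, 0) \<le> u (start A, 0)"
  proof (rule star_least[OF pos_lin_chain])
    fix c :: "'q \<times> int"
    show "?a c + chain A w u c \<le> u c"
    proof (cases "c \<in> good")
      case True
      then have c: "fst c \<in> states A" "0 \<le> snd c" "snd c \<le> int (length w) + 1"
        by (auto simp: good_def)
      have supp: "x \<in> good" "fst x \<in> states A" "snd c - 1 \<le> snd x" "snd x \<le> snd c + 1"
        if "x \<in> set_pmf (step A w c)" "fst c \<notin> halting A" for x
        using set_pmf_step[OF A w c(1) that(2) c(2,3) that(1)] unfolding good_def by blast+
      show ?thesis
      proof (cases "snd c \<le> k")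
        case left: True
        have "chain A w u c = chain A w ?V c"
        proof (rule chain_cong)
          fix x assume x: "x \<in> set_pmf (step A w c)" "fst c \<notin> halting A"
          show "u x = ?V x"
          proof (cases "snd x \<le> k")
            case False
            then have "snd x = k + 1" using supp(4)[OF x] left by simp
            then show ?thesis using entry[OF supp(2)[OF x]] supp(1)[OF x] by (simp only: u_def) simp
          qed (use supp(1)[OF x] in \<open>simp only: u_def\<close>, simp)
        qed
        moreover have "?V c = left_accept A k c + chain A w ?V c"
          using unf[of c] left by (auto simp: jump_op_def left_chain_def entries_def)
        ultimately show ?thesis using True left by (auto simp: u_def left_accept_def indicator_def)
      next
        case right: False
        have "chain A w u c = chain A w (star ?R e) c"
        proof (rule chain_cong)
          fix x assume x: "x \<in> set_pmf (step A w c)" "fst c \<notin> halting A"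
          show "u x = star ?R e x"
          proof (cases "snd x \<le> k")
            case True
            then have "snd x = k" using supp(3)[OF x] right by simp
            then show ?thesis using exit[OF supp(2)[OF x]] supp(1)[OF x] by (simp only: u_def) simp
          qed (use supp(1)[OF x] in \<open>simp only: u_def\<close>, simp)
        qed
        moreover have "star ?R e c = e c + chain A w (star ?R e) c"
          using star_unfold[OF pos_lin_right, of A w k e c] right by (simp add: right_chain_def)
        \<comment> \<open>Acceptance right of the cut is paid as an exit to
          \<open>(fst c, k)\<close>, whose value in the jump system is at least 1.\<close>
        moreover have "?a c \<le> e c"
        proof (cases "fst c \<in> accepting A")
          case acc: True
          then have "e c = ?V (fst c, k)"
            unfolding e_def sum_exit_ind[OF fin(1)] using c right by (simp add: halting_def)
          also have "\<dots> \<ge> left_accept A k (fst c, k)" by (subst unf) simp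
          then show ?thesis using acc calculation by (simp add: left_accept_def)
        qed simp
        ultimately show ?thesis using True right by (simp add: u_def add_right_mono)
      qed
    qed (simp add: u_def)
  qed
  then show ?thesis using fin(2) k by (simp add: u_def good_def)
qed

section \<open>Replacing a suffix\<close>

lemma tape_append_right: "0 < i \<Longrightarrow> tape (u @ w) (i + int (length u)) = tape w i"
  by (auto simp: tape_def nth_append nat_add_distrib nat_diff_distrib' algebra_simps)

lemma tape_append_left: "i \<le> int (length u) \<Longrightarrow> tape (u @ w) i = tape (u @ w') i"
  by (auto simp: tape_def nth_append)

lemma left_chain_append:
  "left_chain A (u @ w) (int (length u)) = left_chain A (u @ w') (int (length u))"
  using tape_append_left[of _ u w w']
  by (auto simp: left_chain_def chain_def step_def fun_eq_iff)

text \<open>The right chain reads only cells beyond the cut, and these agree up to a shift in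
  \<open>w\<close> and \<open>u @ w\<close>. Killing at the cut hides the left end-marker that
  precedes \<open>w\<close> alone.\<close>

lemma right_chain_append:
  "(right_chain A (u @ w) (int (length u)) ^^ t) F (q, i + int (length u))
     = (right_chain A w 0 ^^ t) (\<lambda>(q, i). F (q, i + int (length u))) (q, i)"
proof (induction t arbitrary: F q i)
  case (Suc t)
  let ?n = "int (length u)"
  have "(\<lambda>(q, i). right_chain A (u @ w) ?n F (q, i + ?n))
      = right_chain A w 0 (\<lambda>(q, i). F (q, i + ?n))"
    by (auto simp: fun_eq_iff right_chain_def chain_def step_def tape_append_right
      case_prod_unfold add_ac)
  then show ?case using Suc[of "right_chain A (u @ w) ?n F"] by (simp add: funpow_swap1)
qed simp

lemma crossing_append: "crossing A (u @ w) (int (length u)) q q' = crossing A w 0 q q'"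
proof -
  have "(\<lambda>(q, i). exit_ind A (int (length u)) q' (q, i + int (length u))) = exit_ind A 0 q'"
    by (auto simp: exit_ind_def fun_eq_iff)
  then show ?thesis
    using right_chain_append[where A = A and u = u and w = w and F = "exit_ind A (int (length u)) q'"
      and q = q and i = 1]
    by (simp add: crossing_def star_def add.commute)
qed

definition cross_prob :: "('q, 'a) tpfa \<Rightarrow> 'a list \<Rightarrow> 'q \<Rightarrow> 'q \<Rightarrow> real" where
  "cross_prob A w q q' = enn2real (crossing A w 0 q q')"

text \<open>For a 2PFA entering a suffix over its alphabet in one of its states, the probability of
  staying there forever without halting.\<close>

definition loss_prob :: "('q, 'a) tpfa \<Rightarrow> 'a list \<Rightarrow> 'q \<Rightarrow> real" where
  "loss_prob A w q = 1 - (\<Sum>q'\<in>states A. cross_prob A w q q')"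

lemma ennreal_cross_prob:
  assumes "finite (states A)" "q' \<in> states A"
  shows "ennreal (cross_prob A w q q') = crossing A w 0 q q'"
proof -
  have "crossing A w 0 q q' \<le> (\<Sum>q'\<in>states A. crossing A w 0 q q')"
    using assms by (intro member_le_sum) auto
  also have "\<dots> \<le> 1" by (rule sum_crossing_le_1[OF assms(1)])
  finally have "crossing A w 0 q q' \<noteq> \<infinity>" by (auto simp: top_unique)
  then show ?thesis by (simp add: cross_prob_def less_top)
qed

lemma cross_prob_nonneg: "0 \<le> cross_prob A w q q'"
  by (simp add: cross_prob_def)

lemma loss_prob_nonneg:
  assumes "finite (states A)"
  shows "0 \<le> loss_prob A w q"
proof -
  have "ennreal (\<Sum>q'\<in>states A. cross_prob A w q q') = (\<Sum>q'\<in>states A. crossing A w 0 q q')"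
    using assms by (simp add: ennreal_cross_prob cross_prob_nonneg flip: sum_ennreal)
  also have "\<dots> \<le> 1" by (rule sum_crossing_le_1[OF assms])
  finally show ?thesis by (simp add: loss_prob_def)
qed

lemma loss_prob_le_1: "loss_prob A w q \<le> 1"
  by (simp add: loss_prob_def sum_nonneg cross_prob_nonneg)

lemma cross_prob_le_1:
  assumes "finite (states A)" "q' \<in> states A"
  shows "cross_prob A w q q' \<le> 1"
proof -
  have "cross_prob A w q q' \<le> (\<Sum>q'\<in>states A. cross_prob A w q q')"
    using assms by (intro member_le_sum) (auto simp: cross_prob_nonneg)
  then show ?thesis using loss_prob_nonneg[OF assms(1), of w q] by (simp add: loss_prob_def)
qed

text \<open>Both words share the part left of the cut, so the two jump systems differ only in the
  matrix. The visits multiplying the additive error are at most the expected steps on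
  \<open>u @ w\<close> plus 1.\<close>

lemma prob_accepts_close:
  fixes \<beta> \<theta> \<kappa> :: real
  assumes A: "is_2pfa \<Sigma> A" and u: "u \<in> lists \<Sigma>" and w: "w \<in> lists \<Sigma>"
    and \<beta>: "1 \<le> \<beta>" "\<beta> \<le> 2" and \<theta>: "0 \<le> \<theta>"
    and \<kappa>: "\<kappa> = (card (states A) + 1) * \<theta>" "\<kappa> < 1"
    and close: "\<And>q q'. q \<in> states A \<Longrightarrow> q' \<in> states A \<Longrightarrow>
        cross_prob A w q q' \<le> \<beta> * (cross_prob A w' q q' + \<theta>)"
      "\<And>q q'. q \<in> states A \<Longrightarrow> q' \<in> states A \<Longrightarrow>
        cross_prob A w' q q' \<le> \<beta> * (cross_prob A w q q' + \<theta>)"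
      "\<And>q. q \<in> states A \<Longrightarrow> loss_prob A w' q \<le> \<beta> * (loss_prob A w q + \<theta>)"
  shows "prob_accepts A (u @ w) \<le>
      ennreal ((\<beta> / (1 - \<kappa>)) ^ (2 * card (states A))) * prob_accepts A (u @ w')
      + ennreal (3 * \<kappa>) * (expected_steps A (u @ w) + 1)"
proof -
  define k where "k = int (length u)"
  define T where "T = left_chain A (u @ w) k"
  define Y where "Y v c j = cross_prob A v (fst c) (fst j)" for v and c j :: "'b \<times> int"
  let ?op = "\<lambda>v. jump_op T (entries A k) (exits A k) (Y v)"
  have T': "left_chain A (u @ w') k = T" unfolding T_def k_def by (rule left_chain_append)
  have finQ: "finite (states A)" using A by (simp add: is_2pfa_def)
  have cr: "ennreal (Y v (q, k + 1) (q', k)) = crossing A (u @ v) k q q'"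
    if "q' \<in> states A" for v q q'
    using ennreal_cross_prob[OF finQ that] by (simp add: Y_def k_def crossing_append)
  interpret jump_system T "left_accept A k" "entries A k" "exits A k"
    unfolding T_def by (rule jump_system_2pfa[OF A])
  have Y: "substoch (Y v)" for v
    using loss_prob_nonneg[OF finQ, of v]
    by (simp add: substoch_def Y_def sum_exits cross_prob_nonneg loss_prob_def)
  have "prob_accepts A (u @ w) \<le> star (?op w) (left_accept A k) (start A, 0)"
    unfolding prob_accepts_eq T_def
    by (rule value_le_jump_system[OF A]) (use u w cr in \<open>auto simp: k_def\<close>)
  also have "\<dots> \<le> ennreal ((\<beta> / (1 - \<kappa>)) ^ (2 * card (entries A k))) *
        star (?op w') (left_accept A k) (start A, 0)
      + ennreal (3 * \<kappa>) * star (?op w) (indicator (entries A k)) (start A, 0)"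
  proof (rule star_jump_op_close[OF Y Y \<beta> \<theta> _ \<kappa>(2)])
    show "\<kappa> = (card (exits A k) + 1) * \<theta>" using \<kappa>(1) by (simp add: card_exits)
    fix c assume c: "c \<in> entries A k"
    then show "1 - (\<Sum>j\<in>exits A k. Y w' c j) \<le> \<beta> * (1 - (\<Sum>j\<in>exits A k. Y w c j) + \<theta>)"
      using close(3)[of "fst c"] by (auto simp: sum_exits Y_def loss_prob_def entries_def)
    fix j assume "j \<in> exits A k"
    then show "Y w c j \<le> \<beta> * (Y w' c j + \<theta>)" "Y w' c j \<le> \<beta> * (Y w c j + \<theta>)"
      using c close(1,2)[of "fst c" "fst j"] by (auto simp: Y_def entries_def exits_def)
  qed
  also have "\<dots> \<le> ennreal ((\<beta> / (1 - \<kappa>)) ^ (2 * card (states A))) * prob_accepts A (u @ w')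
      + ennreal (3 * \<kappa>) * (expected_steps A (u @ w) + 1)"
  proof (intro add_mono mult_mono)
    show "star (?op w') (left_accept A k) (start A, 0) \<le> prob_accepts A (u @ w')"
      unfolding prob_accepts_eq T'[symmetric] by (rule jump_system_value_le[OF A cr])
    have "star (?op w) (indicator (entries A k)) (start A, 0)
        \<le> star (chain A (u @ w)) (indicator {c. snd c = k + 1}) (start A, 0)"
      unfolding T_def by (rule jump_system_visits_le[OF A cr])
    also have "\<dots> \<le> star (chain A (u @ w)) (\<lambda>_. 1) (start A, 0)"
      by (rule star_mono[OF pos_lin_chain]) (simp add: indicator_def)
    also have "\<dots> \<le> expected_steps A (u @ w) + 1" by (rule star_one_le_expected_steps)
    finally show "star (?op w) (indicator (entries A k)) (start A, 0)
        \<le> expected_steps A (u @ w) + 1" .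
  qed (simp_all add: card_entries)
  finally show ?thesis .
qed

section \<open>Logarithmic rounding and the pigeonhole\<close>

definition level :: "real \<Rightarrow> real \<Rightarrow> real \<Rightarrow> nat" where
  "level \<theta> \<mu> x = nat \<lfloor>ln (1 + x / \<theta>) / \<mu>\<rfloor>"

text \<open>Equal floors put \<open>x + \<theta>\<close> and \<open>y + \<theta>\<close> within a
  factor \<open>exp \<mu>\<close>. The shift by \<open>\<theta>\<close> before taking logarithms is
  what leaves finitely many levels for probabilities.\<close>

lemma level_eqD:
  assumes "level \<theta> \<mu> x = level \<theta> \<mu> y" and "0 < \<theta>" "0 < \<mu>" "0 \<le> x" "0 \<le> y"
  shows "x \<le> exp \<mu> * (y + \<theta>)"
proof -
  have "0 \<le> ln (1 + x / \<theta>) / \<mu>" "0 \<le> ln (1 + y / \<theta>) / \<mu>" using assms by simp_all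
  then have "\<lfloor>ln (1 + x / \<theta>) / \<mu>\<rfloor> = \<lfloor>ln (1 + y / \<theta>) / \<mu>\<rfloor>"
    using assms(1) by (simp add: level_def eq_nat_nat_iff)
  then have "ln (1 + x / \<theta>) / \<mu> \<le> ln (1 + y / \<theta>) / \<mu> + 1" by linarith
  then have "ln (1 + x / \<theta>) \<le> ln (1 + y / \<theta>) + \<mu>" using assms(3) by (simp add: field_simps)
  then have "exp (ln (1 + x / \<theta>)) \<le> exp (ln (1 + y / \<theta>) + \<mu>)" by simp
  moreover have "0 < 1 + x / \<theta>" "0 < 1 + y / \<theta>" using assms by (simp_all add: add_pos_nonneg)
  ultimately have "1 + x / \<theta> \<le> (1 + y / \<theta>) * exp \<mu>" by (simp add: exp_add)
  then have "(1 + x / \<theta>) * \<theta> \<le> (1 + y / \<theta>) * exp \<mu> * \<theta>"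
    using assms(2) by (intro mult_right_mono) auto
  moreover have "(1 + x / \<theta>) * \<theta> = x + \<theta>" "(1 + y / \<theta>) * exp \<mu> * \<theta> = exp \<mu> * (y + \<theta>)"
    using assms(2) by (simp_all add: field_simps)
  ultimately show ?thesis using assms(2) by simp
qed

lemma level_mono:
  assumes "0 < \<theta>" "0 < \<mu>" "0 \<le> x" "x \<le> y"
  shows "level \<theta> \<mu> x \<le> level \<theta> \<mu> y"
  unfolding level_def using assms
  by (intro nat_mono floor_mono divide_right_mono) (simp_all add: divide_right_mono add_pos_nonneg)

text \<open>The key \<open>None\<close> carries the loss. Restriction to a finite domain places
  profiles in a finite function space that can be counted.\<close>

definition profile :: "('q, 'a) tpfa \<Rightarrow> real \<Rightarrow> real \<Rightarrow> 'a list \<Rightarrow> 'q \<times> 'q option \<Rightarrow> nat" where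
  "profile A \<theta> \<mu> w = (\<lambda>(q, x) \<in> states A \<times> insert None (Some ` states A).
     level \<theta> \<mu> (case x of None \<Rightarrow> loss_prob A w q | Some q' \<Rightarrow> cross_prob A w q q'))"

text \<open>Pigeonhole on the \<open>m + 1\<close> lengths from 0 to \<open>m\<close>; probabilities
  are at most 1, so each entry of a profile takes at most \<open>level \<theta> \<mu> 1 + 1\<close>
  values.\<close>

lemma profile_collision:
  assumes fin: "finite (states A)" and pos: "0 < \<theta>" "0 < \<mu>"
    and m: "(level \<theta> \<mu> 1 + 1) ^ (card (states A) * (card (states A) + 1)) \<le> m"
  obtains l l' where "l \<le> m" "l' \<le> m" "l \<noteq> l'"
    "profile A \<theta> \<mu> (replicate l a) = profile A \<theta> \<mu> (replicate l' a)"
proof -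
  let ?D = "states A \<times> insert None (Some ` states A)"
  let ?f = "\<lambda>l. profile A \<theta> \<mu> (replicate l a)"
  have "?f ` {..m} \<subseteq> ?D \<rightarrow>\<^sub>E {..level \<theta> \<mu> 1}"
  proof (rule image_subsetI, rule PiE_I)
    fix l x assume "x \<in> ?D"
    then obtain q y where x: "x = (q, y)" "q \<in> states A" "y = None \<or> (\<exists>q'\<in>states A. y = Some q')"
      by auto
    let ?p = "case y of None \<Rightarrow> loss_prob A (replicate l a) q
      | Some q' \<Rightarrow> cross_prob A (replicate l a) q q'"
    have "0 \<le> ?p" "?p \<le> 1"
      using x(3) fin by (auto simp: loss_prob_nonneg loss_prob_le_1 cross_prob_nonneg cross_prob_le_1)
    then have "level \<theta> \<mu> ?p \<le> level \<theta> \<mu> 1" by (rule level_mono[OF pos])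
    then show "?f l x \<in> {..level \<theta> \<mu> 1}" using x by (auto simp: profile_def)
  qed (auto simp: profile_def restrict_def)
  moreover have "finite (?D \<rightarrow>\<^sub>E {..level \<theta> \<mu> 1})" using fin by (intro finite_PiE) auto
  moreover have "card (?D \<rightarrow>\<^sub>E {..level \<theta> \<mu> 1})
      = (level \<theta> \<mu> 1 + 1) ^ (card (states A) * (card (states A) + 1))"
    using fin by (subst card_PiE) (auto simp: card_cartesian_product card_image)
  ultimately have "card (?f ` {..m}) < card {..m}"
    using m card_mono[of "?D \<rightarrow>\<^sub>E {..level \<theta> \<mu> 1}" "?f ` {..m}"] by simp
  then have "\<not> inj_on ?f {..m}" by (rule pigeonhole)
  then show ?thesis using that by (auto simp: inj_on_def)
qed

lemma profile_eqD:
  assumes "profile A \<theta> \<mu> w = profile A \<theta> \<mu> w'" and "finite (states A)" "0 < \<theta>" "0 < \<mu>"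
    and q: "q \<in> states A"
  shows "q' \<in> states A \<Longrightarrow> cross_prob A w q q' \<le> exp \<mu> * (cross_prob A w' q q' + \<theta>)"
    and "loss_prob A w q \<le> exp \<mu> * (loss_prob A w' q + \<theta>)"
proof -
  show "cross_prob A w q q' \<le> exp \<mu> * (cross_prob A w' q q' + \<theta>)" if "q' \<in> states A"
    using fun_cong[OF assms(1), of "(q, Some q')"] q that
    by (intro level_eqD assms cross_prob_nonneg) (simp add: profile_def)
  show "loss_prob A w q \<le> exp \<mu> * (loss_prob A w' q + \<theta>)"
    using fun_cong[OF assms(1), of "(q, None)"] q
    by (intro level_eqD assms loss_prob_nonneg) (simp add: profile_def)
qed

section \<open>Growth estimates\<close>

lemma poly_le_power:
  fixes p :: "real poly"
  obtains K where "1 \<le> K" "\<And>x. 1 \<le> x \<Longrightarrow> poly p x \<le> K * x ^ degree p"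
proof (rule that)
  let ?K = "1 + (\<Sum>i\<le>degree p. \<bar>coeff p i\<bar>)"
  show "1 \<le> ?K" by (simp add: sum_nonneg)
  fix x :: real assume x: "1 \<le> x"
  have "poly p x = (\<Sum>i\<le>degree p. coeff p i * x ^ i)" by (rule poly_altdef)
  also have "\<dots> \<le> (\<Sum>i\<le>degree p. \<bar>coeff p i\<bar> * x ^ degree p)"
    using x by (intro sum_mono mult_mono power_increasing) auto
  also have "\<dots> \<le> ?K * x ^ degree p"
    using x by (simp add: sum_distrib_right distrib_right)
  finally show "poly p x \<le> ?K * x ^ degree p" .
qed

text \<open>Logarithms bound \<open>ln m\<close> by \<open>c * (c + 1)\<close> times a term
  logarithmic in \<open>c\<close> and \<open>ln m\<close>. Were \<open>ln m = b * x ^ 3\<close> with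
  \<open>c < x\<close>, the right side would be at most a multiple of \<open>x ^ 3\<close> in which
  \<open>b\<close> enters only as \<open>b / 2\<close>, impossible for large
  \<open>b\<close>.\<close>

lemma ln_le_cube_of_le_power:
  fixes \<eta> K :: real and d :: nat
  assumes \<eta>: "0 < \<eta>" and K: "1 \<le> K"
  obtains b where "0 < b" and "\<And>(c::nat) (m::nat). 1 \<le> c \<Longrightarrow> 1 \<le> m \<Longrightarrow>
    real m \<le> (1 + 8 * real c / \<eta> * ln (1 + 32 * real c ^ 2 * (K * real m ^ d + 1) / \<eta>)) ^ (c * (c + 1)) \<Longrightarrow>
    ln m \<le> b * real c ^ 3"
proof -
  \<comment> \<open>\<open>M * (c + ln m)\<close> will bound the logarithm and
    \<open>E * (c * (c + ln m))\<close> the base of the power; \<open>b\<close> satisfies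
    \<open>2 * (ln E + b / 4 + 10) < b\<close>.\<close>
  define M where "M = ln (1 + 64 * K / \<eta>) + 2 + d"
  define E where "E = 1 + 8 * M / \<eta>"
  define b where "b = 4 * (ln E + 11)"
  have M0: "0 \<le> M" using \<eta> K by (simp add: M_def)
  have E1: "1 \<le> E" using M0 \<eta> by (simp add: E_def)
  have lnE: "0 \<le> ln E" using E1 by simp
  have b: "1 \<le> b" using lnE by (simp add: b_def)
  have bound: "ln m \<le> b * real c ^ 3" if c: "1 \<le> c" and m: "1 \<le> m" and
    le: "real m \<le> (1 + 8 * real c / \<eta> * ln (1 + 32 * real c ^ 2 * (K * real m ^ d + 1) / \<eta>)) ^ (c * (c + 1))"
    for c m :: nat
  proof (rule ccontr)
    assume "\<not> ?thesis"
    then have big: "b * real c ^ 3 < ln m" by simp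
    let ?L = "ln (real m)" and ?c = "real c"
    have c': "1 \<le> ?c" and m': "1 \<le> real m" using c m by auto
    have L0: "0 \<le> ?L" using m' by simp
    have cm: "1 \<le> ?c\<^sup>2 * real m ^ d" "1 \<le> real m ^ d"
      using c' m' mult_mono[of 1 "?c\<^sup>2" 1 "real m ^ d"] by (simp_all add: one_le_power)
    have "1 + 32 * ?c\<^sup>2 * (K * real m ^ d + 1) / \<eta> \<le> (1 + 64 * K / \<eta>) * (?c\<^sup>2 * real m ^ d)"
    proof -
      have "1 \<le> K * real m ^ d" using mult_mono[of 1 K 1 "real m ^ d"] K cm by simp
      then have "32 * ?c\<^sup>2 * (K * real m ^ d + 1) \<le> 32 * ?c\<^sup>2 * (2 * (K * real m ^ d))"
        by (intro mult_left_mono) auto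
      then have "32 * ?c\<^sup>2 * (K * real m ^ d + 1) / \<eta> \<le> 32 * ?c\<^sup>2 * (2 * (K * real m ^ d)) / \<eta>"
        using \<eta> by (simp add: divide_right_mono)
      moreover have "(1 + 64 * K / \<eta>) * (?c\<^sup>2 * real m ^ d)
          = ?c\<^sup>2 * real m ^ d + 32 * ?c\<^sup>2 * (2 * (K * real m ^ d)) / \<eta>"
        using \<eta> by (simp add: field_simps)
      ultimately show ?thesis using cm(1) by linarith
    qed
    moreover have pos: "0 < 1 + 32 * ?c\<^sup>2 * (K * real m ^ d + 1) / \<eta>"
      using \<eta> K by (intro add_pos_nonneg) auto
    ultimately have "ln (1 + 32 * ?c\<^sup>2 * (K * real m ^ d + 1) / \<eta>)
        \<le> ln ((1 + 64 * K / \<eta>) * (?c\<^sup>2 * real m ^ d))" by simp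
    also have "\<dots> = ln (1 + 64 * K / \<eta>) + (2 * ln ?c + d * ?L)"
    proof -
      have "0 < 1 + 64 * K / \<eta>" using \<eta> K by (intro add_pos_nonneg) auto
      then show ?thesis using c' m' by (simp add: ln_mult ln_realpow)
    qed
    also have "\<dots> \<le> M * (?c + ?L)"
    proof -
      have "ln ?c \<le> ?c" using ln_bound[of ?c] c' by simp
      moreover have "ln (1 + 64 * K / \<eta>) * 1 \<le> ln (1 + 64 * K / \<eta>) * (?c + ?L)"
        using \<eta> K c' L0 by (intro mult_left_mono) auto
      moreover have "M * (?c + ?L) = ln (1 + 64 * K / \<eta>) * (?c + ?L) + 2 * ?c + 2 * ?L + d * ?c + d * ?L"
        by (simp add: M_def algebra_simps)
      moreover have "0 \<le> real d * ?c" by simp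
      ultimately show ?thesis using L0 by linarith
    qed
    finally have "8 * ?c / \<eta> * ln (1 + 32 * ?c\<^sup>2 * (K * real m ^ d + 1) / \<eta>)
        \<le> 8 * ?c / \<eta> * (M * (?c + ?L))" using \<eta> by (intro mult_left_mono) auto
    moreover have "1 \<le> ?c * (?c + ?L)" using mult_mono[of 1 ?c 1 "?c + ?L"] c' L0 by simp
    moreover have "E * (?c * (?c + ?L)) = ?c * (?c + ?L) + 8 * ?c / \<eta> * (M * (?c + ?L))"
      using \<eta> by (simp add: E_def field_simps)
    ultimately have base: "1 + 8 * ?c / \<eta> * ln (1 + 32 * ?c\<^sup>2 * (K * real m ^ d + 1) / \<eta>)
        \<le> E * (?c * (?c + ?L))" by linarith
    have ln0: "0 \<le> ln (1 + 32 * ?c\<^sup>2 * (K * real m ^ d + 1) / \<eta>)" using \<eta> K by simp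
    have base0: "0 \<le> 1 + 8 * ?c / \<eta> * ln (1 + 32 * ?c\<^sup>2 * (K * real m ^ d + 1) / \<eta>)"
      using ln0 \<eta> by simp
    have "real m \<le> (E * (?c * (?c + ?L))) ^ (c * (c + 1))"
      using le power_mono[OF base base0] by (rule order_trans)
    then have "?L \<le> ln ((E * (?c * (?c + ?L))) ^ (c * (c + 1)))" using m' by (subst ln_le_cancel_iff) auto
    also have "\<dots> = real (c * (c + 1)) * (ln E + ln ?c + ln (?c + ?L))"
      using E1 c' L0 by (simp add: ln_realpow ln_mult add_ac)
    finally have L: "?L \<le> real (c * (c + 1)) * (ln E + ln ?c + ln (?c + ?L))" .
    define x where "x = root 3 (?L / b)"
    have x3: "?L = b * x ^ 3" using b L0 by (simp add: x_def)
    have cx: "?c < x"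
    proof -
      have "?c ^ 3 < ?L / b" using big b by (simp add: pos_less_divide_eq mult.commute)
      then have "root 3 (?c ^ 3) < root 3 (?L / b)" by (rule real_root_less_mono[OF zero_less_numeral])
      then show ?thesis by (simp add: x_def real_root_power_cancel)
    qed
    have x1: "1 \<le> x" using cx c' by simp
    have "x \<le> x ^ 3" using power_increasing[of 1 3 x] x1 by simp
    then have "?c + ?L \<le> 2 * (b * x ^ 3)"
    proof -
      have "1 * x ^ 3 \<le> b * x ^ 3" using b x1 by (intro mult_right_mono) auto
      then show ?thesis using cx x3 \<open>x \<le> x ^ 3\<close> by linarith
    qed
    then have "ln (?c + ?L) \<le> ln (2 * (b * x ^ 3))" using c' L0 by (subst ln_le_cancel_iff) auto
    \<comment> \<open>Splitting off the 4 makes \<open>b\<close> enter linearly with coefficient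
      1/4, small enough for the final contradiction.\<close>
    also have "\<dots> = ln (b / 4) + ln 8 + 3 * ln x"
      using b x1 by (simp add: ln_mult ln_realpow ln_div) (simp add: ln_mult[of 2 4, simplified])
    also have "\<dots> \<le> b / 4 + 6 + 3 * x"
      using ln_le_minus_one[of "b / 4"] ln_le_minus_one[of 8] ln_bound[of x] b x1 by simp
    finally have l1: "ln (?c + ?L) \<le> b / 4 + 6 + 3 * x" .
    have "ln ?c \<le> x" using ln_bound[of ?c] c' cx by simp
    with l1 have "ln E + ln ?c + ln (?c + ?L) \<le> ln E + b / 4 + 6 + 4 * x" by simp
    also have "\<dots> \<le> (ln E + b / 4 + 6) * x + 4 * x"
      using mult_left_mono[OF x1, of "ln E + b / 4 + 6"] lnE b by simp
    finally have l2: "ln E + ln ?c + ln (?c + ?L) \<le> (ln E + b / 4 + 10) * x"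
      by (simp add: distrib_right)
    have "real (c * (c + 1)) \<le> 2 * x\<^sup>2"
    proof -
      have "?c * (?c + 1) \<le> x * (2 * x)" using cx c' by (intro mult_mono) auto
      then show ?thesis by (simp add: power2_eq_square algebra_simps)
    qed
    then have "real (c * (c + 1)) * (ln E + ln ?c + ln (?c + ?L))
        \<le> 2 * x\<^sup>2 * ((ln E + b / 4 + 10) * x)"
      using l2 lnE c' L0 by (intro mult_mono) auto
    with L x3 have "b * x ^ 3 \<le> 2 * (ln E + b / 4 + 10) * x ^ 3"
      by (simp add: power2_eq_square power3_eq_cube mult_ac)
    then have "b \<le> 2 * (ln E + b / 4 + 10)" using x1 by (subst (asm) mult_le_cancel_right) auto
    then show False using lnE by (simp add: b_def)
  qed
  show ?thesis using that[of b] b bound by simp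
qed

section \<open>The lower bound\<close>

text \<open>Otherwise two suffix lengths collide, and a common prefix extends one suffix to length
  \<open>m\<close> and the other to a different length. The acceptance probabilities are then too
  close for the gap \<open>1 - 2 * \<epsilon>\<close>.\<close>

lemma length_lt_profile_count:
  fixes A :: "('q, 'a) tpfa"
  assumes \<epsilon>: "0 < \<epsilon>" "\<epsilon> < 1 / 2" and \<Sigma>: "a \<in> \<Sigma>" and A: "is_2pfa \<Sigma> A"
    and rec: "recognizes_with_error \<Sigma> A (C \<Sigma> m) \<epsilon>"
    and P: "0 \<le> P" "expected_steps A (replicate m a) \<le> ennreal P"
  defines "\<eta> \<equiv> (1 - 2 * \<epsilon>) / 2" and "c \<equiv> card (states A)"
  shows "real m \<le> (1 + 8 * real c / \<eta> * ln (1 + 32 * real c ^ 2 * (P + 1) / \<eta>)) ^ (c * (c + 1))"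
proof -
  have \<eta>: "0 < \<eta>" "\<eta> < 1 / 2" using \<epsilon> by (simp_all add: \<eta>_def)
  have fin: "finite (states A)" using A by (simp add: is_2pfa_def)
  moreover have "states A \<noteq> {}" using A by (auto simp: is_2pfa_def)
  ultimately have c: "1 \<le> c" by (simp add: c_def Suc_le_eq card_gt_0_iff)
  then have c': "1 \<le> real c" by simp
  \<comment> \<open>\<open>\<mu>\<close> makes the accumulated factor
    \<open>exp (4 * c * \<mu>)\<close> equal to \<open>exp (\<eta> / 2)\<close>, and
    \<open>\<theta>\<close> makes \<open>\<kappa> * (P + 1)\<close> at most
    \<open>\<mu> / 2\<close>. Their inverses are the quotients in the stated bound.\<close>
  define \<theta> where "\<theta> = \<eta> / (32 * real c ^ 2 * (P + 1))"
  define \<mu> where "\<mu> = \<eta> / (8 * real c)"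
  define \<kappa> where "\<kappa> = (c + 1) * \<theta>"
  have \<theta>: "0 < \<theta>" using \<eta> c' P by (simp add: \<theta>_def)
  have \<mu>: "0 < \<mu>" "\<mu> \<le> 1 / 16" using \<eta> c' by (simp_all add: \<mu>_def field_simps)
  have \<kappa>0: "0 \<le> \<kappa>" using \<theta> by (simp add: \<kappa>_def)
  have \<kappa>P: "\<kappa> * (P + 1) \<le> \<mu> / 2"
  proof -
    have "\<kappa> * (P + 1) = (real c + 1) * (\<eta> / (32 * real c ^ 2))"
      using P by (simp add: \<kappa>_def \<theta>_def)
    also have "\<dots> \<le> (2 * real c) * (\<eta> / (32 * real c ^ 2))"
      using c' \<eta> by (intro mult_right_mono) auto
    also have "\<dots> = \<mu> / 2" using c' by (simp add: \<mu>_def power2_eq_square)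
    finally show ?thesis .
  qed
  have "\<kappa> * 1 \<le> \<kappa> * (P + 1)" using \<kappa>0 P by (intro mult_left_mono) auto
  then have \<kappa>: "\<kappa> \<le> \<mu> / 2" using \<kappa>P by simp
  have \<kappa>half: "\<kappa> \<le> 1 / 32" using \<kappa> \<mu> by simp
  have \<beta>: "1 \<le> exp \<mu>" "exp \<mu> \<le> 2"
  proof -
    have "\<mu>\<^sup>2 \<le> \<mu>" using \<mu> by (simp add: power2_eq_square mult_left_le)
    then show "exp \<mu> \<le> 2" using exp_bound[of \<mu>] \<mu> by simp
  qed (use \<mu> in simp)
  have ratio: "(exp \<mu> / (1 - \<kappa>)) ^ (2 * c) \<le> 1 + \<eta>"
  proof -
    \<comment> \<open>The factor \<open>1 / (1 - \<kappa>)\<close> is absorbed into a second factor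
      \<open>exp \<mu>\<close>.\<close>
    have "1 \<le> (1 + 2 * \<kappa>) * (1 - \<kappa>)"
      using mult_nonneg_nonneg[OF \<kappa>0, of "1 - 2 * \<kappa>"] \<kappa>half by (simp add: algebra_simps)
    also have "\<dots> \<le> exp (2 * \<kappa>) * (1 - \<kappa>)"
      using \<kappa>half exp_ge_add_one_self[of "2 * \<kappa>"] by (intro mult_right_mono) auto
    finally have "1 / (1 - \<kappa>) \<le> exp (2 * \<kappa>)" using \<kappa>half by (simp add: pos_divide_le_eq)
    also have "\<dots> \<le> exp \<mu>" using \<kappa> by simp
    finally have "exp \<mu> * (1 / (1 - \<kappa>)) \<le> exp \<mu> * exp \<mu>" by (intro mult_left_mono) auto
    then have "(exp \<mu> / (1 - \<kappa>)) ^ (2 * c) \<le> exp (2 * \<mu>) ^ (2 * c)"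
      using \<kappa>half by (intro power_mono) (simp_all add: exp_add[symmetric])
    also have "\<dots> = exp (\<eta> / 2)"
      using c' by (simp add: exp_of_nat_mult[symmetric] \<mu>_def)
    also have "\<dots> \<le> 1 + \<eta> / 2 + (\<eta> / 2)\<^sup>2" using \<eta> by (intro exp_bound) auto
    also have "(\<eta> / 2)\<^sup>2 = \<eta> / 4 * \<eta>" by (simp add: power2_eq_square)
    also have "1 + \<eta> / 2 + \<eta> / 4 * \<eta> \<le> 1 + \<eta>"
      using \<eta> mult_right_mono[of "\<eta> / 4" "1 / 2" \<eta>] by linarith
    finally show ?thesis .
  qed
  have "m < (level \<theta> \<mu> 1 + 1) ^ (c * (c + 1))"
  proof (rule ccontr)
    assume "\<not> ?thesis"
    then have "(level \<theta> \<mu> 1 + 1) ^ (card (states A) * (card (states A) + 1)) \<le> m"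
      by (simp add: c_def)
    from profile_collision[OF fin \<theta> \<mu>(1) this, of a] obtain l l' where l: "l \<le> m" "l \<noteq> l'" and
      eq: "profile A \<theta> \<mu> (replicate l a) = profile A \<theta> \<mu> (replicate l' a)" by metis
    \<comment> \<open>The padding brings the first suffix to length \<open>m\<close>, so the time
      bound is applied to \<open>replicate m a\<close> alone.\<close>
    define u where "u = replicate (m - l) a"
    let ?w = "replicate l a" and ?w' = "replicate l' a"
    have words: "u \<in> lists \<Sigma>" "?w \<in> lists \<Sigma>" "?w' \<in> lists \<Sigma>" using \<Sigma> by (auto simp: u_def)
    have uw: "u @ ?w = replicate m a" using l by (simp add: u_def flip: replicate_add)
    have "replicate m a \<in> lists \<Sigma>" using \<Sigma> by auto
    then have "u @ ?w \<in> C \<Sigma> m" by (simp only: uw C_def) simp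
    then have acc: "ennreal (1 - \<epsilon>) \<le> prob_accepts A (u @ ?w)"
      using rec by (simp add: recognizes_with_error_def)
    have "u @ ?w' \<in> lists \<Sigma> - C \<Sigma> m" using words l by (auto simp: C_def u_def)
    then have "ennreal (1 - \<epsilon>) \<le> prob_rejects A (u @ ?w')"
      using rec by (simp add: recognizes_with_error_def)
    then have "prob_accepts A (u @ ?w') + ennreal (1 - \<epsilon>)
        \<le> prob_accepts A (u @ ?w') + prob_rejects A (u @ ?w')" by (rule add_left_mono)
    also have "\<dots> \<le> 1" using A by (intro prob_accepts_plus_rejects) (simp add: is_2pfa_def)
    also have "1 = ennreal \<epsilon> + ennreal (1 - \<epsilon>)" using \<epsilon> by (simp flip: ennreal_plus)
    finally have "ennreal (1 - \<epsilon>) + prob_accepts A (u @ ?w') \<le> ennreal (1 - \<epsilon>) + ennreal \<epsilon>"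
      by (simp only: add.commute)
    then have rej: "prob_accepts A (u @ ?w') \<le> ennreal \<epsilon>"
      by (simp add: ennreal_add_left_cancel_le)
    have "prob_accepts A (u @ ?w)
        \<le> ennreal ((exp \<mu> / (1 - \<kappa>)) ^ (2 * card (states A))) * prob_accepts A (u @ ?w')
          + ennreal (3 * \<kappa>) * (expected_steps A (u @ ?w) + 1)"
    proof (rule prob_accepts_close[OF A words(1,2) \<beta>])
      show "0 \<le> \<theta>" "\<kappa> = (card (states A) + 1) * \<theta>" "\<kappa> < 1"
        using \<theta> \<kappa>half by (simp_all add: \<kappa>_def c_def)
    qed (use profile_eqD[OF eq fin \<theta> \<mu>(1)] profile_eqD[OF eq[symmetric] fin \<theta> \<mu>(1)] in blast)+
    also have "\<dots> \<le> ennreal (1 + \<eta>) * ennreal \<epsilon> + ennreal (3 * \<kappa>) * (ennreal P + 1)"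
      using ratio rej P \<kappa>0 unfolding uw c_def[symmetric]
      by (intro add_mono mult_mono ennreal_leI) auto
    also have "\<dots> = ennreal ((1 + \<eta>) * \<epsilon> + 3 * (\<kappa> * (P + 1)))"
      using \<eta> \<epsilon> P \<kappa>0 by (simp add: ennreal_mult mult.assoc flip: ennreal_1)
    finally have "ennreal (1 - \<epsilon>) \<le> ennreal ((1 + \<eta>) * \<epsilon> + 3 * (\<kappa> * (P + 1)))"
      using acc by (rule order_trans[rotated])
    then have "1 - \<epsilon> \<le> (1 + \<eta>) * \<epsilon> + 3 * (\<kappa> * (P + 1))"
      using \<eta> \<epsilon> P \<kappa>0 by (subst (asm) ennreal_le_iff) auto
    moreover have "\<mu> \<le> \<eta> / 8" using \<eta> c' by (simp add: \<mu>_def field_simps)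
    moreover have "\<eta> * \<epsilon> \<le> \<eta> * (1 / 2)" using \<eta> \<epsilon> by (intro mult_left_mono) auto
    \<comment> \<open>The gap is \<open>2 * \<eta>\<close>, whereas the errors add up to at most
      \<open>\<eta> / 2 + 3 * \<eta> / 16\<close>.\<close>
    moreover have "1 - \<epsilon> = \<epsilon> + 2 * \<eta>" by (simp add: \<eta>_def field_simps)
    ultimately show False using \<kappa>P \<eta> by (simp add: distrib_right)
  qed
  then have "real m \<le> real ((level \<theta> \<mu> 1 + 1) ^ (c * (c + 1)))"
    by (simp only: of_nat_le_iff less_imp_le)
  also have "\<dots> = (1 + real (level \<theta> \<mu> 1)) ^ (c * (c + 1))"
    by (simp only: of_nat_power of_nat_add of_nat_1 add.commute)
  also have "\<dots> \<le> (1 + 8 * real c / \<eta> * ln (1 + 32 * real c ^ 2 * (P + 1) / \<eta>)) ^ (c * (c + 1))"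
  proof (rule power_mono)
    have "0 \<le> ln (1 + 1 / \<theta>) / \<mu>" using \<theta> \<mu> by simp
    then have "real (level \<theta> \<mu> 1) \<le> ln (1 + 1 / \<theta>) / \<mu>"
      by (simp add: level_def)
    also have "\<dots> = 8 * real c / \<eta> * ln (1 + 32 * real c ^ 2 * (P + 1) / \<eta>)"
      by (simp add: \<theta>_def \<mu>_def)
    finally show "1 + real (level \<theta> \<mu> 1)
        \<le> 1 + 8 * real c / \<eta> * ln (1 + 32 * real c ^ 2 * (P + 1) / \<eta>)" by simp
  qed simp
  finally show ?thesis .
qed

theorem theorem13:
  fixes \<epsilon> :: real and p :: "real poly"
  assumes "0 < \<epsilon>" and "\<epsilon> < 1 / 2"
  shows "\<exists>b > 0. \<forall>(\<Sigma> :: 'a set) (m :: nat) (A :: ('q, 'a) tpfa).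
           finite \<Sigma> \<and> \<Sigma> \<noteq> {} \<and> m \<ge> 1 \<and> is_2pfa \<Sigma> A \<and>
           expected_time_bounded \<Sigma> A p \<and> recognizes_with_error \<Sigma> A (C \<Sigma> m) \<epsilon> \<longrightarrow>
           real (card (states A)) \<ge> root 3 (log 2 (real m) / b)"
proof -
  define \<eta> where "\<eta> = (1 - 2 * \<epsilon>) / 2"
  have \<eta>: "0 < \<eta>" using assms by (simp add: \<eta>_def)
  obtain K where K: "1 \<le> K" "\<And>x. 1 \<le> x \<Longrightarrow> poly p x \<le> K * x ^ degree p"
    using poly_le_power[of p] by blast
  obtain b where b: "0 < b" "\<And>(c::nat) (m::nat). 1 \<le> c \<Longrightarrow> 1 \<le> m \<Longrightarrow>
      real m \<le> (1 + 8 * real c / \<eta> * ln (1 + 32 * real c ^ 2 * (K * real m ^ degree p + 1) / \<eta>))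
        ^ (c * (c + 1)) \<Longrightarrow> ln m \<le> b * real c ^ 3"
    using ln_le_cube_of_le_power[OF \<eta> K(1), of "degree p"] by blast
  show ?thesis
  \<comment> \<open>Division by \<open>ln 2\<close> converts natural logarithms to base 2. The
    constant comes from \<open>\<epsilon>\<close> and \<open>p\<close> alone, before alphabet,
    \<open>m\<close> and automaton are fixed.\<close>
  proof (intro exI[of _ "b / ln 2"] conjI allI impI)
    show "0 < b / ln 2" using b by simp
    fix \<Sigma> :: "'a set" and m and A :: "('q, 'a) tpfa"
    assume asm: "finite \<Sigma> \<and> \<Sigma> \<noteq> {} \<and> m \<ge> 1 \<and> is_2pfa \<Sigma> A \<and>
      expected_time_bounded \<Sigma> A p \<and> recognizes_with_error \<Sigma> A (C \<Sigma> m) \<epsilon>"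
    then obtain a where a: "a \<in> \<Sigma>" by auto
    have A: "is_2pfa \<Sigma> A" and m: "1 \<le> m" using asm by auto
    have c: "1 \<le> card (states A)"
      using A by (auto simp: is_2pfa_def Suc_le_eq card_gt_0_iff)
    have "replicate m a \<in> lists \<Sigma>" using a by auto
    moreover have "\<forall>w\<in>lists \<Sigma>. expected_steps A w \<le> ennreal (poly p (real (length w)))"
      using asm by (simp add: expected_time_bounded_def)
    ultimately have "expected_steps A (replicate m a) \<le> ennreal (poly p (real m))"
      by (metis length_replicate)
    also have "\<dots> \<le> ennreal (K * real m ^ degree p)" using K(2)[of "real m"] m by (simp add: ennreal_leI)
    finally have steps: "expected_steps A (replicate m a) \<le> ennreal (K * real m ^ degree p)" .
    have "ln m \<le> b * real (card (states A)) ^ 3"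
    proof (rule b(2)[OF c m], unfold \<eta>_def, rule length_lt_profile_count[OF assms a A])
      show "recognizes_with_error \<Sigma> A (C \<Sigma> m) \<epsilon>" using asm by blast
      show "0 \<le> K * real m ^ degree p" using K(1) by simp
    qed (rule steps)
    then have "log 2 (real m) / (b / ln 2) \<le> real (card (states A)) ^ 3"
      using b(1) by (simp add: log_def field_simps)
    then have "root 3 (log 2 (real m) / (b / ln 2)) \<le> root 3 (real (card (states A)) ^ 3)"
      by (intro real_root_le_mono) auto
    then show "root 3 (log 2 (real m) / (b / ln 2)) \<le> real (card (states A))"
      by (simp add: real_root_power_cancel)
  qed
qed

end
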